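(* Let $(\mathcal B,\otimes,\mathbb 1)$ be a braided monoidal category with a twist $\theta$, let $H$ be a Hopf algebra in $\mathcal B$, let $C$ be an $H$-module coalgebra in $\mathcal B$, let $(\delta,\sigma)$ be a modular pair for $H$, and let $\alpha\colon\mathbb 1\to C$ be a $\delta$-invariant $\sigma$-trace for $C$. Then the family $\{\alpha_n\colon H^{\otimes n}\to C^{\otimes n+1}\}_{n\in\mathbb N}$ is a morphism of paracocyclic objects in $\mathcal B$ from $\mathbf{CM}_\bullet(H,\delta,\sigma)$ to $\mathbf C_\bullet(C)$; that is, it commutes with all cofaces, all codegeneracies and all paracocyclic operators.
   Context: Associativity and unit constraints are suppressed; $X^{\otimes0}=\mathbb 1$; $\mathbb N$ contains $0$. The braiding $c=\{c_{X,Y}\colon X\otimes Y\to Y\otimes X\}$ satisfies $c_{X,Y\otimes Z}=(\mathrm{id}_Y\otimes c_{X,Z})(c_{X,Y}\otimes\mathrm{id}_Z)$ and $c_{X\otimes Y,Z}=(c_{X,Z}\otimes\mathrm{id}_Y)(\mathrm{id}_X\otimes c_{Y,Z})$. A twist is a natural isomorphism $\theta=\{\theta_X\colon X\to X\}$ with $\theta_{X\otimes Y}=(\theta_X\otimes\theta_Y)c_{Y,X}c_{X,Y}$. A Hopf algebra in $\mathcal B$ is $(H,m,u,\Delta,\varepsilon,S)$ where $(H,m,u)$ is an algebra and $(H,\Delta,\varepsilon)$ a coalgebra in $\mathcal B$, $\Delta m=(m\otimes m)(\mathrm{id}_H\otimes c_{H,H}\otimes\mathrm{id}_H)(\Delta\otimes\Delta)$,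 $\Delta u=u\otimes u$, $\varepsilon m=\varepsilon\otimes\varepsilon$, $\varepsilon u=\mathrm{id}_{\mathbb 1}$, and $S\colon H\to H$ is an isomorphism with $m(S\otimes\mathrm{id}_H)\Delta=u\varepsilon=m(\mathrm{id}_H\otimes S)\Delta$. A modular pair for $H$ is a pair $(\delta,\sigma)$ with $\delta\colon H\to\mathbb 1$ an algebra morphism and $\sigma\colon\mathbb 1\to H$ a coalgebra morphism such that $\delta\sigma=\mathrm{id}_{\mathbb 1}$. Paracocyclic objects: a paracocyclic object in $\mathcal B$ is a family $\{Y_n\}_{n\in\mathbb N}$ of objects with cofaces $d_i^n\colon Y_{n-1}\to Y_n$ ($n\ge1$, $0\le i\le n$), codegeneracies $s_j^n\colon Y_{n+1}\to Y_n$ ($n\ge0$, $0\le j\le n$) satisfying the cosimplicial identities, and isomorphisms $t_n\colon Y_n\to Y_n$ (paracocyclic operators) with $t_nd_i=d_{i-1}t_{n-1}$ and $t_ns_i=s_{i-1}t_{n+1}$ for $1\le i\le n$, $t_nd_0=d_n$, $t_ns_0=s_nt_{n+1}^2$. A morphism of paracocyclic objects is a family of morphisms $\beta_n\colon Y_n\to Y'_n$ with $\beta_nd_i^n=d_i^n\beta_{n-1}$, $\beta_ns_j^n=s_j^n\beta_{n+1}$, $\beta_nt_n=t_n\beta_n$. The paracocyclic object $\mathbf{CM}_\bullet(H,\delta,\sigma)$: $\mathbf{CM}_n(H,\delta,\sigma)=H^{\otimes n}$; cofaces $d_0^n=u\otimes\mathrm{id}_{H^{\otimes n-1}}$, $d_i^n=\mathrm{id}_{H^{\otimes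 i-1}}\otimes\Delta\otimes\mathrm{id}_{H^{\otimes n-1-i}}$ for $1\le i\le n-1$, $d_n^n=\mathrm{id}_{H^{\otimes n-1}}\otimes\sigma$; codegeneracies $s_j^n=\mathrm{id}_{H^{\otimes j}}\otimes\varepsilon\otimes\mathrm{id}_{H^{\otimes n-j}}$; paracocyclic operators $t_0=\tau_0(\delta,\sigma)=\mathrm{id}_{\mathbb 1}$ and $t_n=\tau_n(\delta,\sigma)=\lambda_n(\tilde S\otimes\mathrm{id}_{H^{\otimes n-1}}\otimes\sigma)$ for $n\ge1$, where $\tilde S=(\delta\otimes S)\Delta$ and the left diagonal action $\lambda_n\colon H\otimes H^{\otimes n}\to H^{\otimes n}$ is given by $\lambda_0=\varepsilon$, $\lambda_n=(m\otimes\lambda_{n-1})(\mathrm{id}_H\otimes c_{H,H}\otimes\mathrm{id}_{H^{\otimes n-1}})(\Delta\otimes\mathrm{id}_{H^{\otimes n}})$. The paracocyclic object $\mathbf C_\bullet(C)$ of a coalgebra $(C,\Delta_C,\varepsilon_C)$ in $\mathcal B$: $\mathbf C_n(C)=C^{\otimes n+1}$; cofaces $d_i^n=\mathrm{id}_{C^{\otimes i}}\otimes\Delta_C\otimes\mathrm{id}_{C^{\otimes n-1-i}}$ for $0\le i\le n-1$ and $d_n^n=(\mathrm{id}_{C^{\otimes n}}\otimes\theta_C)\,c_{C,C^{\otimes n}}\,(\Delta_C\otimes\mathrm{id}_{C^{\otimes n-1}})$; codegeneracies $s_j^n=\mathrm{id}_{C^{\otimes j+1}}\otimes\varepsilon_C\otimes\mathrm{id}_{C^{\otimes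 n-j}}$; paracocyclic operators $t_0=\theta_C$ and $t_n=(\mathrm{id}_{C^{\otimes n}}\otimes\theta_C)\,c_{C,C^{\otimes n}}$ for $n\ge1$. An $H$-module coalgebra is a coalgebra $(C,\Delta_C,\varepsilon_C)$ in $\mathcal B$ with a right $H$-action $r\colon C\otimes H\to C$ such that $\Delta_Cr=(r\otimes r)(\mathrm{id}_C\otimes c_{C,H}\otimes\mathrm{id}_H)(\Delta_C\otimes\Delta)$ and $\varepsilon_Cr=\varepsilon_C\otimes\varepsilon$. A $\delta$-invariant $\sigma$-trace for $C$ is a morphism $\alpha\colon\mathbb 1\to C$ with $r(\alpha\otimes\mathrm{id}_H)=\alpha\delta$ and $(\mathrm{id}_C\otimes r)(\Delta_C\alpha\otimes\sigma)=(\mathrm{id}_C\otimes\theta_C)\,c_{C,C}\,\Delta_C\alpha$. Given such $\alpha$: let $\Delta_C^{(1)}=\mathrm{id}_C$, $\Delta_C^{(n+1)}=(\mathrm{id}_C\otimes\Delta_C^{(n)})\Delta_C\colon C\to C^{\otimes n+1}$, and let $\rho_n\colon C^{\otimes n}\otimes H^{\otimes n}\to C^{\otimes n}$ be given by $\rho_1=r$, $\rho_n=(r\otimes\rho_{n-1})(\mathrm{id}_C\otimes c_{C^{\otimes n-1},H}\otimes\mathrm{id}_{H^{\otimes n-1}})$ (the $i$-th factor of $H^{\otimes n}$ acts on the $i$-th factor of $C^{\otimes n}$). Then $\alpha_0=\alpha$ and $\alpha_n=(\mathrm{id}_C\otimes\rho_n)\bigl(\Delta_C^{(n+1)}\alpha\otimes\mathrm{id}_{H^{\otimes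 n}}\bigr)\colon H^{\otimes n}\to C^{\otimes n+1}$ for $n\ge1$. *)

theory Defs
  imports Main
begin

section \<open>Braided monoidal categories with a twist\<close>

record ('o, 'm) category =
  Obj :: "'o set"
  Arr :: "'m set"
  Dom :: "'m \<Rightarrow> 'o"
  Cod :: "'m \<Rightarrow> 'o"
  iden :: "'o \<Rightarrow> 'm"
  comp :: "'m \<Rightarrow> 'm \<Rightarrow> 'm"  (infixr "\<cdot>\<index>" 60)

record ('o, 'm) monoidal_category = "('o, 'm) category" +
  tunit :: "'o"  ("\<I>\<index>")
  tobj :: "'o \<Rightarrow> 'o \<Rightarrow> 'o"  (infixr "\<otimes>\<index>" 70)
  tarr :: "'m \<Rightarrow> 'm \<Rightarrow> 'm"  (infixr "\<star>\<index>" 70)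
  assoc :: "'o \<Rightarrow> 'o \<Rightarrow> 'o \<Rightarrow> 'm"
  lunit :: "'o \<Rightarrow> 'm"
  runit :: "'o \<Rightarrow> 'm"

record ('o, 'm) braided_category = "('o, 'm) monoidal_category" +
  braid :: "'o \<Rightarrow> 'o \<Rightarrow> 'm"

record ('o, 'm) twisted_category = "('o, 'm) braided_category" +
  twist :: "'o \<Rightarrow> 'm"

definition hom :: "('o, 'm, 'x) category_scheme \<Rightarrow> 'o \<Rightarrow> 'o \<Rightarrow> 'm set" where
  "hom B X Y = {f \<in> Arr B. Dom B f = X \<and> Cod B f = Y}"

definition inverse_arrows :: "('o, 'm, 'x) category_scheme \<Rightarrow> 'm \<Rightarrow> 'm \<Rightarrow> bool" where
  "inverse_arrows B f g \<longleftrightarrow>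
     f \<in> Arr B \<and> g \<in> hom B (Cod B f) (Dom B f) \<and>
     g \<cdot>\<^bsub>B\<^esub> f = iden B (Dom B f) \<and> f \<cdot>\<^bsub>B\<^esub> g = iden B (Cod B f)"

definition is_iso :: "('o, 'm, 'x) category_scheme \<Rightarrow> 'm \<Rightarrow> bool" where
  "is_iso B f \<longleftrightarrow> (\<exists>g. inverse_arrows B f g)"

definition inv_arr :: "('o, 'm, 'x) category_scheme \<Rightarrow> 'm \<Rightarrow> 'm" where
  "inv_arr B f = (THE g. inverse_arrows B f g)"

locale category =
  fixes B (structure)
  assumes Dom_Cod_Obj: "f \<in> Arr B \<Longrightarrow> Dom B f \<in> Obj B \<and> Cod B f \<in> Obj B"
    and iden_hom: "X \<in> Obj B \<Longrightarrow> iden B X \<in> hom B X X"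
    and comp_hom: "\<lbrakk>f \<in> hom B X Y; g \<in> hom B Y Z\<rbrakk> \<Longrightarrow> g \<cdot> f \<in> hom B X Z"
    and comp_assoc: "\<lbrakk>f \<in> hom B X Y; g \<in> hom B Y Z; h \<in> hom B Z W\<rbrakk>
          \<Longrightarrow> (h \<cdot> g) \<cdot> f = h \<cdot> (g \<cdot> f)"
    and comp_iden_left: "f \<in> hom B X Y \<Longrightarrow> iden B Y \<cdot> f = f"
    and comp_iden_right: "f \<in> hom B X Y \<Longrightarrow> f \<cdot> iden B X = f"

locale monoidal_category = category B for B (structure) +
  assumes tunit_Obj: "\<I> \<in> Obj B"
    and tobj_Obj: "\<lbrakk>X \<in> Obj B; Y \<in> Obj B\<rbrakk> \<Longrightarrow> X \<otimes> Y \<in> Obj B"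
    and tarr_hom: "\<lbrakk>f \<in> hom B X Y; g \<in> hom B X' Y'\<rbrakk>
          \<Longrightarrow> f \<star> g \<in> hom B (X \<otimes> X') (Y \<otimes> Y')"
    and tarr_iden: "\<lbrakk>X \<in> Obj B; Y \<in> Obj B\<rbrakk>
          \<Longrightarrow> iden B X \<star> iden B Y = iden B (X \<otimes> Y)"
    and interchange: "\<lbrakk>f \<in> hom B X Y; g \<in> hom B Y Z; f' \<in> hom B X' Y'; g' \<in> hom B Y' Z'\<rbrakk>
          \<Longrightarrow> (g \<cdot> f) \<star> (g' \<cdot> f') = (g \<star> g') \<cdot> (f \<star> f')"
    and assoc_hom: "\<lbrakk>X \<in> Obj B; Y \<in> Obj B; Z \<in> Obj B\<rbrakk>
          \<Longrightarrow> assoc B X Y Z \<in> hom B ((X \<otimes> Y) \<otimes> Z) (X \<otimes> (Y \<otimes> Z))"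
    and assoc_iso: "\<lbrakk>X \<in> Obj B; Y \<in> Obj B; Z \<in> Obj B\<rbrakk> \<Longrightarrow> is_iso B (assoc B X Y Z)"
    and assoc_natural: "\<lbrakk>f \<in> hom B X X'; g \<in> hom B Y Y'; h \<in> hom B Z Z'\<rbrakk>
          \<Longrightarrow> assoc B X' Y' Z' \<cdot> ((f \<star> g) \<star> h) = (f \<star> (g \<star> h)) \<cdot> assoc B X Y Z"
    and lunit_hom: "X \<in> Obj B \<Longrightarrow> lunit B X \<in> hom B (\<I> \<otimes> X) X"
    and lunit_iso: "X \<in> Obj B \<Longrightarrow> is_iso B (lunit B X)"
    and lunit_natural: "f \<in> hom B X Y \<Longrightarrow> lunit B Y \<cdot> (iden B \<I> \<star> f) = f \<cdot> lunit B X"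
    and runit_hom: "X \<in> Obj B \<Longrightarrow> runit B X \<in> hom B (X \<otimes> \<I>) X"
    and runit_iso: "X \<in> Obj B \<Longrightarrow> is_iso B (runit B X)"
    and runit_natural: "f \<in> hom B X Y \<Longrightarrow> runit B Y \<cdot> (f \<star> iden B \<I>) = f \<cdot> runit B X"
    and pentagon: "\<lbrakk>X \<in> Obj B; Y \<in> Obj B; Z \<in> Obj B; W \<in> Obj B\<rbrakk>
          \<Longrightarrow> assoc B X Y (Z \<otimes> W) \<cdot> assoc B (X \<otimes> Y) Z W =
             (iden B X \<star> assoc B Y Z W) \<cdot> assoc B X (Y \<otimes> Z) W \<cdot> (assoc B X Y Z \<star> iden B W)"
    and triangle: "\<lbrakk>X \<in> Obj B; Y \<in> Obj B\<rbrakk>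
          \<Longrightarrow> (iden B X \<star> lunit B Y) \<cdot> assoc B X \<I> Y = runit B X \<star> iden B Y"

locale braided_category = monoidal_category B for B (structure) +
  assumes braid_hom: "\<lbrakk>X \<in> Obj B; Y \<in> Obj B\<rbrakk> \<Longrightarrow> braid B X Y \<in> hom B (X \<otimes> Y) (Y \<otimes> X)"
    and braid_iso: "\<lbrakk>X \<in> Obj B; Y \<in> Obj B\<rbrakk> \<Longrightarrow> is_iso B (braid B X Y)"
    and braid_natural: "\<lbrakk>f \<in> hom B X X'; g \<in> hom B Y Y'\<rbrakk>
          \<Longrightarrow> braid B X' Y' \<cdot> (f \<star> g) = (g \<star> f) \<cdot> braid B X Y"
    and hexagon_right: "\<lbrakk>X \<in> Obj B; Y \<in> Obj B; Z \<in> Obj B\<rbrakk>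
          \<Longrightarrow> assoc B Y Z X \<cdot> braid B X (Y \<otimes> Z) \<cdot> assoc B X Y Z =
             (iden B Y \<star> braid B X Z) \<cdot> assoc B Y X Z \<cdot> (braid B X Y \<star> iden B Z)"
    and hexagon_left: "\<lbrakk>X \<in> Obj B; Y \<in> Obj B; Z \<in> Obj B\<rbrakk>
          \<Longrightarrow> inv_arr B (assoc B Z X Y) \<cdot> braid B (X \<otimes> Y) Z \<cdot> inv_arr B (assoc B X Y Z) =
             (braid B X Z \<star> iden B Y) \<cdot> inv_arr B (assoc B X Z Y) \<cdot> (iden B X \<star> braid B Y Z)"

locale twisted_category = braided_category B for B (structure) +
  assumes twist_hom: "X \<in> Obj B \<Longrightarrow> twist B X \<in> hom B X X"
    and twist_iso: "X \<in> Obj B \<Longrightarrow> is_iso B (twist B X)"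
    and twist_natural: "f \<in> hom B X Y \<Longrightarrow> twist B Y \<cdot> f = f \<cdot> twist B X"
    and twist_tobj: "\<lbrakk>X \<in> Obj B; Y \<in> Obj B\<rbrakk>
          \<Longrightarrow> twist B (X \<otimes> Y) = (twist B X \<star> twist B Y) \<cdot> braid B Y X \<cdot> braid B X Y"


section \<open>Suppressing the constraints\<close>

text \<open>
  The categories are not assumed strict. Formulas in which associativity and unit constraints
  are suppressed are read in the strictification: a word \<open>[X\<^sub>1, \<dots>, X\<^sub>n]\<close> stands for the tensor
  product \<open>X\<^sub>1 \<otimes> (X\<^sub>2 \<otimes> (\<dots> \<otimes> X\<^sub>n))\<close>, and \<open>Warr xs f ys\<close> is the arrow
  \<open>f : tens xs \<rightarrow> tens ys\<close> together with the factorisations of its ends. Tensor products and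
  braidings of such arrows are conjugated by the canonical isomorphisms
  \<open>merge xs ys : tens xs \<otimes> tens ys \<rightarrow> tens (xs @ ys)\<close>.
\<close>

datatype ('o, 'm) warr = Warr (wdom: "'o list") (und: 'm) (wcod: "'o list")

fun tens :: "('o, 'm, 'x) monoidal_category_scheme \<Rightarrow> 'o list \<Rightarrow> 'o" where
  "tens B [] = \<I>\<^bsub>B\<^esub>"
| "tens B [X] = X"
| "tens B (X # Y # zs) = X \<otimes>\<^bsub>B\<^esub> tens B (Y # zs)"

fun merge :: "('o, 'm, 'x) monoidal_category_scheme \<Rightarrow> 'o list \<Rightarrow> 'o list \<Rightarrow> 'm" where
  "merge B [] ys = lunit B (tens B ys)"
| "merge B [X] [] = runit B X"
| "merge B [X] (Y # ys) = iden B (X \<otimes>\<^bsub>B\<^esub> tens B (Y # ys))"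
| "merge B (X # X' # xs) ys =
     (iden B X \<star>\<^bsub>B\<^esub> merge B (X' # xs) ys) \<cdot>\<^bsub>B\<^esub> assoc B X (tens B (X' # xs)) (tens B ys)"

definition wid :: "('o, 'm, 'x) monoidal_category_scheme \<Rightarrow> 'o list \<Rightarrow> ('o, 'm) warr" where
  "wid B xs = Warr xs (iden B (tens B xs)) xs"

definition wcomp :: "('o, 'm, 'x) monoidal_category_scheme
    \<Rightarrow> ('o, 'm) warr \<Rightarrow> ('o, 'm) warr \<Rightarrow> ('o, 'm) warr"  (infixr "\<bullet>\<index>" 60) where
  "g \<bullet>\<^bsub>B\<^esub> f = Warr (wdom f) (und g \<cdot>\<^bsub>B\<^esub> und f) (wcod g)"

definition wtens :: "('o, 'm, 'x) monoidal_category_scheme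
    \<Rightarrow> ('o, 'm) warr \<Rightarrow> ('o, 'm) warr \<Rightarrow> ('o, 'm) warr"  (infixr "\<boxtimes>\<index>" 70) where
  "f \<boxtimes>\<^bsub>B\<^esub> g = Warr (wdom f @ wdom g)
     (merge B (wcod f) (wcod g) \<cdot>\<^bsub>B\<^esub> (und f \<star>\<^bsub>B\<^esub> und g)
        \<cdot>\<^bsub>B\<^esub> inv_arr B (merge B (wdom f) (wdom g)))
     (wcod f @ wcod g)"

definition wbraid :: "('o, 'm, 'x) braided_category_scheme
    \<Rightarrow> 'o list \<Rightarrow> 'o list \<Rightarrow> ('o, 'm) warr" where
  "wbraid B xs ys = Warr (xs @ ys)
     (merge B ys xs \<cdot>\<^bsub>B\<^esub> braid B (tens B xs) (tens B ys) \<cdot>\<^bsub>B\<^esub> inv_arr B (merge B xs ys))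
     (ys @ xs)"

definition wtwist :: "('o, 'm, 'x) twisted_category_scheme \<Rightarrow> 'o list \<Rightarrow> ('o, 'm) warr" where
  "wtwist B xs = Warr xs (twist B (tens B xs)) xs"

abbreviation idpow :: "('o, 'm, 'x) monoidal_category_scheme \<Rightarrow> 'o \<Rightarrow> nat \<Rightarrow> ('o, 'm) warr" where
  "idpow B X n \<equiv> wid B (replicate n X)"


section \<open>Coalgebras, Hopf algebras, module coalgebras\<close>

record ('o, 'm) coalgebra =
  ob :: "'o"
  comult :: "'m"
  counit :: "'m"

record ('o, 'm) hopf_algebra = "('o, 'm) coalgebra" +
  mult :: "'m"
  unit :: "'m"
  antipode :: "'m"

record ('o, 'm) module_coalgebra = "('o, 'm) coalgebra" +
  act :: "'m"

abbreviation wcomult :: "('o, 'm, 'x) coalgebra_scheme \<Rightarrow> ('o, 'm) warr"  ("\<Delta>\<^bsub>_\<^esub>") where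
  "\<Delta>\<^bsub>A\<^esub> \<equiv> Warr [ob A] (comult A) [ob A, ob A]"

abbreviation wcounit :: "('o, 'm, 'x) coalgebra_scheme \<Rightarrow> ('o, 'm) warr"  ("\<epsilon>\<^bsub>_\<^esub>") where
  "\<epsilon>\<^bsub>A\<^esub> \<equiv> Warr [ob A] (counit A) []"

abbreviation wmult :: "('o, 'm, 'x) hopf_algebra_scheme \<Rightarrow> ('o, 'm) warr"  ("\<mu>\<^bsub>_\<^esub>") where
  "\<mu>\<^bsub>H\<^esub> \<equiv> Warr [ob H, ob H] (mult H) [ob H]"

abbreviation wunit :: "('o, 'm, 'x) hopf_algebra_scheme \<Rightarrow> ('o, 'm) warr"  ("\<eta>\<^bsub>_\<^esub>") where
  "\<eta>\<^bsub>H\<^esub> \<equiv> Warr [] (unit H) [ob H]"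

abbreviation wantipode :: "('o, 'm, 'x) hopf_algebra_scheme \<Rightarrow> ('o, 'm) warr"  ("\<S>\<^bsub>_\<^esub>") where
  "\<S>\<^bsub>H\<^esub> \<equiv> Warr [ob H] (antipode H) [ob H]"

locale coalgebra = monoidal_category B for B (structure) +
  fixes A :: "('o, 'm, 'x) coalgebra_scheme"
  assumes ob_Obj: "ob A \<in> Obj B"
    and comult_hom: "comult A \<in> hom B (ob A) (ob A \<otimes> ob A)"
    and counit_hom: "counit A \<in> hom B (ob A) \<I>"
    and coassoc: "(\<Delta>\<^bsub>A\<^esub> \<boxtimes> wid B [ob A]) \<bullet> \<Delta>\<^bsub>A\<^esub> = (wid B [ob A] \<boxtimes> \<Delta>\<^bsub>A\<^esub>) \<bullet> \<Delta>\<^bsub>A\<^esub>"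
    and counit_left: "(\<epsilon>\<^bsub>A\<^esub> \<boxtimes> wid B [ob A]) \<bullet> \<Delta>\<^bsub>A\<^esub> = wid B [ob A]"
    and counit_right: "(wid B [ob A] \<boxtimes> \<epsilon>\<^bsub>A\<^esub>) \<bullet> \<Delta>\<^bsub>A\<^esub> = wid B [ob A]"

locale hopf_algebra = braided_category B + coalgebra B H
  for B (structure) and H :: "('o, 'm, 'x) hopf_algebra_scheme" +
  assumes mult_hom: "mult H \<in> hom B (ob H \<otimes> ob H) (ob H)"
    and unit_hom: "unit H \<in> hom B \<I> (ob H)"
    and antipode_hom: "antipode H \<in> hom B (ob H) (ob H)"
    and mult_assoc: "\<mu>\<^bsub>H\<^esub> \<bullet> (\<mu>\<^bsub>H\<^esub> \<boxtimes> wid B [ob H]) = \<mu>\<^bsub>H\<^esub> \<bullet> (wid B [ob H] \<boxtimes> \<mu>\<^bsub>H\<^esub>)"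
    and unit_left: "\<mu>\<^bsub>H\<^esub> \<bullet> (\<eta>\<^bsub>H\<^esub> \<boxtimes> wid B [ob H]) = wid B [ob H]"
    and unit_right: "\<mu>\<^bsub>H\<^esub> \<bullet> (wid B [ob H] \<boxtimes> \<eta>\<^bsub>H\<^esub>) = wid B [ob H]"
    and comult_mult: "\<Delta>\<^bsub>H\<^esub> \<bullet> \<mu>\<^bsub>H\<^esub> =
          (\<mu>\<^bsub>H\<^esub> \<boxtimes> \<mu>\<^bsub>H\<^esub>) \<bullet> (wid B [ob H] \<boxtimes> wbraid B [ob H] [ob H] \<boxtimes> wid B [ob H]) \<bullet> (\<Delta>\<^bsub>H\<^esub> \<boxtimes> \<Delta>\<^bsub>H\<^esub>)"
    and comult_unit: "\<Delta>\<^bsub>H\<^esub> \<bullet> \<eta>\<^bsub>H\<^esub> = \<eta>\<^bsub>H\<^esub> \<boxtimes> \<eta>\<^bsub>H\<^esub>"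
    and counit_mult: "\<epsilon>\<^bsub>H\<^esub> \<bullet> \<mu>\<^bsub>H\<^esub> = \<epsilon>\<^bsub>H\<^esub> \<boxtimes> \<epsilon>\<^bsub>H\<^esub>"
    and counit_unit: "\<epsilon>\<^bsub>H\<^esub> \<bullet> \<eta>\<^bsub>H\<^esub> = wid B []"
    and antipode_iso: "is_iso B (antipode H)"
    and antipode_left: "\<mu>\<^bsub>H\<^esub> \<bullet> (\<S>\<^bsub>H\<^esub> \<boxtimes> wid B [ob H]) \<bullet> \<Delta>\<^bsub>H\<^esub> = \<eta>\<^bsub>H\<^esub> \<bullet> \<epsilon>\<^bsub>H\<^esub>"
    and antipode_right: "\<mu>\<^bsub>H\<^esub> \<bullet> (wid B [ob H] \<boxtimes> \<S>\<^bsub>H\<^esub>) \<bullet> \<Delta>\<^bsub>H\<^esub> = \<eta>\<^bsub>H\<^esub> \<bullet> \<epsilon>\<^bsub>H\<^esub>"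

abbreviation wchar :: "('o, 'm, 'x) hopf_algebra_scheme \<Rightarrow> 'm \<Rightarrow> ('o, 'm) warr" where
  "wchar H \<delta> \<equiv> Warr [ob H] \<delta> []"

abbreviation wpoint :: "('o, 'm, 'x) coalgebra_scheme \<Rightarrow> 'm \<Rightarrow> ('o, 'm) warr" where
  "wpoint A \<sigma> \<equiv> Warr [] \<sigma> [ob A]"

locale modular_pair = hopf_algebra B H
  for B (structure) and H :: "('o, 'm, 'x) hopf_algebra_scheme" +
  fixes \<delta> \<sigma> :: 'm
  assumes delta_hom: "\<delta> \<in> hom B (ob H) \<I>"
    and delta_mult: "wchar H \<delta> \<bullet> \<mu>\<^bsub>H\<^esub> = wchar H \<delta> \<boxtimes> wchar H \<delta>"
    and delta_unit: "wchar H \<delta> \<bullet> \<eta>\<^bsub>H\<^esub> = wid B []"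
    and sigma_hom: "\<sigma> \<in> hom B \<I> (ob H)"
    and comult_sigma: "\<Delta>\<^bsub>H\<^esub> \<bullet> wpoint H \<sigma> = wpoint H \<sigma> \<boxtimes> wpoint H \<sigma>"
    and counit_sigma: "\<epsilon>\<^bsub>H\<^esub> \<bullet> wpoint H \<sigma> = wid B []"
    and delta_sigma: "wchar H \<delta> \<bullet> wpoint H \<sigma> = wid B []"

abbreviation wact :: "('o, 'm, 'x) coalgebra_scheme \<Rightarrow> ('o, 'm, 'y) module_coalgebra_scheme
    \<Rightarrow> ('o, 'm) warr" where
  "wact H C \<equiv> Warr [ob C, ob H] (act C) [ob C]"

locale module_coalgebra = H: hopf_algebra B H + C: coalgebra B C
  for B (structure) and H :: "('o, 'm, 'x) hopf_algebra_scheme"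
    and C :: "('o, 'm, 'y) module_coalgebra_scheme" +
  assumes act_hom: "act C \<in> hom B (ob C \<otimes> ob H) (ob C)"
    and act_mult: "wact H C \<bullet> (wact H C \<boxtimes> wid B [ob H]) = wact H C \<bullet> (wid B [ob C] \<boxtimes> \<mu>\<^bsub>H\<^esub>)"
    and act_unit: "wact H C \<bullet> (wid B [ob C] \<boxtimes> \<eta>\<^bsub>H\<^esub>) = wid B [ob C]"
    and comult_act: "\<Delta>\<^bsub>C\<^esub> \<bullet> wact H C =
          (wact H C \<boxtimes> wact H C) \<bullet> (wid B [ob C] \<boxtimes> wbraid B [ob C] [ob H] \<boxtimes> wid B [ob H])
            \<bullet> (\<Delta>\<^bsub>C\<^esub> \<boxtimes> \<Delta>\<^bsub>H\<^esub>)"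
    and counit_act: "\<epsilon>\<^bsub>C\<^esub> \<bullet> wact H C = \<epsilon>\<^bsub>C\<^esub> \<boxtimes> \<epsilon>\<^bsub>H\<^esub>"

definition invariant_trace :: "('o, 'm, 'b) twisted_category_scheme
    \<Rightarrow> ('o, 'm, 'x) hopf_algebra_scheme \<Rightarrow> ('o, 'm, 'y) module_coalgebra_scheme
    \<Rightarrow> 'm \<Rightarrow> 'm \<Rightarrow> 'm \<Rightarrow> bool" where
  "invariant_trace B H C \<delta> \<sigma> \<alpha> \<longleftrightarrow>
     \<alpha> \<in> hom B \<I>\<^bsub>B\<^esub> (ob C) \<and>
     wact H C \<bullet>\<^bsub>B\<^esub> (wpoint C \<alpha> \<boxtimes>\<^bsub>B\<^esub> wid B [ob H]) = wpoint C \<alpha> \<bullet>\<^bsub>B\<^esub> wchar H \<delta> \<and>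
     (wid B [ob C] \<boxtimes>\<^bsub>B\<^esub> wact H C) \<bullet>\<^bsub>B\<^esub> ((\<Delta>\<^bsub>C\<^esub> \<bullet>\<^bsub>B\<^esub> wpoint C \<alpha>) \<boxtimes>\<^bsub>B\<^esub> wpoint H \<sigma>) =
       (wid B [ob C] \<boxtimes>\<^bsub>B\<^esub> wtwist B [ob C]) \<bullet>\<^bsub>B\<^esub> wbraid B [ob C] [ob C] \<bullet>\<^bsub>B\<^esub> \<Delta>\<^bsub>C\<^esub> \<bullet>\<^bsub>B\<^esub> wpoint C \<alpha>"


section \<open>Paracocyclic objects\<close>

text \<open>
  \<open>coface Y n i : Y\<^sub>n\<^sub>-\<^sub>1 \<rightarrow> Y\<^sub>n\<close> is used for \<open>1 \<le> n\<close>, \<open>i \<le> n\<close>, and \<open>codeg Y n j : Y\<^sub>n\<^sub>+\<^sub>1 \<rightarrow> Y\<^sub>n\<close>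
  for \<open>j \<le> n\<close>; other indices carry no meaning. The record holds the structure maps only, not
  the paracocyclic identities, which the notion of morphism does not mention.
\<close>

record ('o, 'm) paracocyclic =
  pobj :: "nat \<Rightarrow> 'o"
  coface :: "nat \<Rightarrow> nat \<Rightarrow> 'm"
  codeg :: "nat \<Rightarrow> nat \<Rightarrow> 'm"
  cycop :: "nat \<Rightarrow> 'm"

definition paracocyclic_morphism :: "('o, 'm, 'b) category_scheme
    \<Rightarrow> ('o, 'm) paracocyclic \<Rightarrow> ('o, 'm) paracocyclic \<Rightarrow> (nat \<Rightarrow> 'm) \<Rightarrow> bool" where
  "paracocyclic_morphism B Y Y' \<beta> \<longleftrightarrow>
     (\<forall>n. \<beta> n \<in> hom B (pobj Y n) (pobj Y' n)) \<and>
     (\<forall>n i. 1 \<le> n \<and> i \<le> n \<longrightarrow> \<beta> n \<cdot>\<^bsub>B\<^esub> coface Y n i = coface Y' n i \<cdot>\<^bsub>B\<^esub> \<beta> (n - 1)) \<and>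
     (\<forall>n j. j \<le> n \<longrightarrow> \<beta> n \<cdot>\<^bsub>B\<^esub> codeg Y n j = codeg Y' n j \<cdot>\<^bsub>B\<^esub> \<beta> (n + 1)) \<and>
     (\<forall>n. \<beta> n \<cdot>\<^bsub>B\<^esub> cycop Y n = cycop Y' n \<cdot>\<^bsub>B\<^esub> \<beta> n)"

primrec diag_action :: "('o, 'm, 'b) braided_category_scheme
    \<Rightarrow> ('o, 'm, 'x) hopf_algebra_scheme \<Rightarrow> nat \<Rightarrow> ('o, 'm) warr" where
  "diag_action B H 0 = \<epsilon>\<^bsub>H\<^esub>"
| "diag_action B H (Suc n) =
     (\<mu>\<^bsub>H\<^esub> \<boxtimes>\<^bsub>B\<^esub> diag_action B H n)
       \<bullet>\<^bsub>B\<^esub> (wid B [ob H] \<boxtimes>\<^bsub>B\<^esub> wbraid B [ob H] [ob H] \<boxtimes>\<^bsub>B\<^esub> idpow B (ob H) n)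
       \<bullet>\<^bsub>B\<^esub> (\<Delta>\<^bsub>H\<^esub> \<boxtimes>\<^bsub>B\<^esub> idpow B (ob H) (Suc n))"

definition twisted_antipode :: "('o, 'm, 'b) monoidal_category_scheme
    \<Rightarrow> ('o, 'm, 'x) hopf_algebra_scheme \<Rightarrow> 'm \<Rightarrow> ('o, 'm) warr" where
  "twisted_antipode B H \<delta> = (wchar H \<delta> \<boxtimes>\<^bsub>B\<^esub> \<S>\<^bsub>H\<^esub>) \<bullet>\<^bsub>B\<^esub> \<Delta>\<^bsub>H\<^esub>"

definition CM :: "('o, 'm, 'b) braided_category_scheme
    \<Rightarrow> ('o, 'm, 'x) hopf_algebra_scheme \<Rightarrow> 'm \<Rightarrow> 'm \<Rightarrow> ('o, 'm) paracocyclic" where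
  "CM B H \<delta> \<sigma> = \<lparr>
     pobj = (\<lambda>n. tens B (replicate n (ob H))),
     coface = (\<lambda>n i. und (
       if i = 0 then \<eta>\<^bsub>H\<^esub> \<boxtimes>\<^bsub>B\<^esub> idpow B (ob H) (n - 1)
       else if i = n then idpow B (ob H) (n - 1) \<boxtimes>\<^bsub>B\<^esub> wpoint H \<sigma>
       else idpow B (ob H) (i - 1) \<boxtimes>\<^bsub>B\<^esub> \<Delta>\<^bsub>H\<^esub> \<boxtimes>\<^bsub>B\<^esub> idpow B (ob H) (n - 1 - i))),
     codeg = (\<lambda>n j. und (idpow B (ob H) j \<boxtimes>\<^bsub>B\<^esub> \<epsilon>\<^bsub>H\<^esub> \<boxtimes>\<^bsub>B\<^esub> idpow B (ob H) (n - j))),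
     cycop = (\<lambda>n. und (
       if n = 0 then wid B []
       else diag_action B H n
         \<bullet>\<^bsub>B\<^esub> (twisted_antipode B H \<delta> \<boxtimes>\<^bsub>B\<^esub> idpow B (ob H) (n - 1) \<boxtimes>\<^bsub>B\<^esub> wpoint H \<sigma>))) \<rparr>"

definition CC :: "('o, 'm, 'b) twisted_category_scheme
    \<Rightarrow> ('o, 'm, 'y) coalgebra_scheme \<Rightarrow> ('o, 'm) paracocyclic" where
  "CC B C = \<lparr>
     pobj = (\<lambda>n. tens B (replicate (n + 1) (ob C))),
     coface = (\<lambda>n i. und (
       if i < n then idpow B (ob C) i \<boxtimes>\<^bsub>B\<^esub> \<Delta>\<^bsub>C\<^esub> \<boxtimes>\<^bsub>B\<^esub> idpow B (ob C) (n - 1 - i)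
       else (idpow B (ob C) n \<boxtimes>\<^bsub>B\<^esub> wtwist B [ob C])
         \<bullet>\<^bsub>B\<^esub> wbraid B [ob C] (replicate n (ob C))
         \<bullet>\<^bsub>B\<^esub> (\<Delta>\<^bsub>C\<^esub> \<boxtimes>\<^bsub>B\<^esub> idpow B (ob C) (n - 1)))),
     codeg = (\<lambda>n j. und (idpow B (ob C) (j + 1) \<boxtimes>\<^bsub>B\<^esub> \<epsilon>\<^bsub>C\<^esub> \<boxtimes>\<^bsub>B\<^esub> idpow B (ob C) (n - j))),
     cycop = (\<lambda>n. und (
       if n = 0 then wtwist B [ob C]
       else (idpow B (ob C) n \<boxtimes>\<^bsub>B\<^esub> wtwist B [ob C])
         \<bullet>\<^bsub>B\<^esub> wbraid B [ob C] (replicate n (ob C)))) \<rparr>"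


section \<open>The comparison family\<close>

text \<open>\<open>iter_comult B C n\<close> is the iterated comultiplication \<open>C \<rightarrow> C\<^sup>\<otimes>\<^sup>n\<^sup>+\<^sup>1\<close>, often written \<open>\<Delta>\<^sup>(\<^sup>n\<^sup>+\<^sup>1\<^sup>)\<close>.\<close>

primrec iter_comult :: "('o, 'm, 'b) monoidal_category_scheme
    \<Rightarrow> ('o, 'm, 'y) coalgebra_scheme \<Rightarrow> nat \<Rightarrow> ('o, 'm) warr" where
  "iter_comult B C 0 = wid B [ob C]"
| "iter_comult B C (Suc n) = (wid B [ob C] \<boxtimes>\<^bsub>B\<^esub> iter_comult B C n) \<bullet>\<^bsub>B\<^esub> \<Delta>\<^bsub>C\<^esub>"

text \<open>The value of \<open>factor_action\<close> at \<open>0\<close> is a convention and is not used below.\<close>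

fun factor_action :: "('o, 'm, 'b) braided_category_scheme
    \<Rightarrow> ('o, 'm, 'x) hopf_algebra_scheme \<Rightarrow> ('o, 'm, 'y) module_coalgebra_scheme
    \<Rightarrow> nat \<Rightarrow> ('o, 'm) warr" where
  "factor_action B H C 0 = wid B []"
| "factor_action B H C (Suc 0) = wact H C"
| "factor_action B H C (Suc (Suc n)) =
     (wact H C \<boxtimes>\<^bsub>B\<^esub> factor_action B H C (Suc n))
       \<bullet>\<^bsub>B\<^esub> (wid B [ob C] \<boxtimes>\<^bsub>B\<^esub> wbraid B (replicate (Suc n) (ob C)) [ob H]
              \<boxtimes>\<^bsub>B\<^esub> idpow B (ob H) (Suc n))"

definition trace_map :: "('o, 'm, 'b) braided_category_scheme
    \<Rightarrow> ('o, 'm, 'x) hopf_algebra_scheme \<Rightarrow> ('o, 'm, 'y) module_coalgebra_scheme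
    \<Rightarrow> 'm \<Rightarrow> nat \<Rightarrow> 'm" where
  "trace_map B H C \<alpha> n =
     (if n = 0 then \<alpha>
      else und ((wid B [ob C] \<boxtimes>\<^bsub>B\<^esub> factor_action B H C n)
             \<bullet>\<^bsub>B\<^esub> ((iter_comult B C n \<bullet>\<^bsub>B\<^esub> wpoint C \<alpha>) \<boxtimes>\<^bsub>B\<^esub> idpow B (ob H) n)))"

end

(* In the strictification (words of objects, with the canonical isomorphisms absorbed by
   Kelly's form of the coherence theorem) one can argue with composites of whiskered arrows up to
   interchange. Put
     iact n = rho_n (Delta_C^(n) [x] id) : C [x] H^n -> C^n,   alpha_n = (id [x] iact n) (Delta_C alpha [x] id).
   Coassociativity splits iact (m + n) into iact m and iact n, so the inner cofaces and the
   codegeneracies reduce to the module coalgebra axioms; moreover iact n turns the diagonal action of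
   H on H^n into the action of H on C. With delta-invariance the latter gives
     alpha_n lambda_n (S~ [x] id) = iact (n + 1) (alpha [x] id),
   and the sigma-trace identity gives
     t_n alpha_n = iact (n + 1) (alpha [x] id [x] sigma).
   Together these are the compatibility with t_n, and the last coface is t_n after the first one. *)
theory Submission
  imports Defs
begin

section \<open>Categories\<close>

text \<open>Interchange is left to rewriting with the rules \<open>layers\<close>, which contain no
  rule for braidings. This dictates the shape of the calculations: a chain regroups a composite
  until one braiding stands next to one structure map, uses naturality or an axiom at that place,
  and regroups again.

  The twisted antipode is explained by a computation in Sweedler notation, up to braidings. Write
  alpha_1 [x] alpha_2 for Delta_C alpha. Since S~(x) = \<delta>(x_1) S(x_2), invariance gives
  alpha_1 [x] alpha_2 S~(x) = alpha_1 x_1 [x] alpha_2 x_2 S(x_3) = alpha_1 x [x] alpha_2, so S~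
  moves an action from the second leg of Delta_C alpha to the first. In the other operator the free
  leg of Delta_C alpha is carried to the far end; the trace identity replaces its twist there by an
  action of \<sigma>. Hence both composites act with n + 1 arguments on all legs of alpha, none of
  them free any more.\<close>

context category
begin

lemma in_hom_iff: "f \<in> hom B X Y \<longleftrightarrow> f \<in> Arr B \<and> Dom B f = X \<and> Cod B f = Y"
  by (auto simp: hom_def)

lemma iden_simps [simp]:
  assumes "X \<in> Obj B"
  shows "iden B X \<in> Arr B" "Dom B (iden B X) = X" "Cod B (iden B X) = X"
  using iden_hom[OF assms] by (simp_all add: in_hom_iff)

lemma comp_simps [simp]:
  assumes "f \<in> Arr B" "g \<in> Arr B" "Cod B f = Dom B g"
  shows "g \<cdot> f \<in> Arr B" "Dom B (g \<cdot> f) = Dom B f" "Cod B (g \<cdot> f) = Cod B g"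
  using comp_hom[of f "Dom B f" "Cod B f" g "Cod B g"] assms by (simp_all add: in_hom_iff)

lemma Dom_Obj [simp]: "f \<in> Arr B \<Longrightarrow> Dom B f \<in> Obj B"
  and Cod_Obj [simp]: "f \<in> Arr B \<Longrightarrow> Cod B f \<in> Obj B"
  using Dom_Cod_Obj by auto

lemma comp_assoc' [simp]:
  assumes "f \<in> Arr B" "g \<in> Arr B" "h \<in> Arr B" "Cod B f = Dom B g" "Cod B g = Dom B h"
  shows "(h \<cdot> g) \<cdot> f = h \<cdot> g \<cdot> f"
  using comp_assoc[of f "Dom B f" "Cod B f" g "Cod B g" h "Cod B h"] assms
  by (simp add: in_hom_iff)

lemma comp_iden [simp]:
  assumes "f \<in> Arr B"
  shows "X = Cod B f \<Longrightarrow> iden B X \<cdot> f = f" "X = Dom B f \<Longrightarrow> f \<cdot> iden B X = f"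
  using comp_iden_left[of f] comp_iden_right[of f] assms by (auto simp: in_hom_iff)

lemma inverse_arrows_unique:
  assumes "inverse_arrows B f g" "inverse_arrows B f h"
  shows "g = h"
proof -
  have g: "f \<in> Arr B" "g \<in> Arr B" "Dom B g = Cod B f" "Cod B g = Dom B f"
    "g \<cdot> f = iden B (Dom B f)" and h: "h \<in> Arr B" "Dom B h = Cod B f" "Cod B h = Dom B f"
    "f \<cdot> h = iden B (Cod B f)"
    using assms by (auto simp: inverse_arrows_def in_hom_iff)
  have "g = g \<cdot> f \<cdot> h" using g h by simp
  also have "\<dots> = (g \<cdot> f) \<cdot> h" using g(1-4) h(1-3) by simp
  also have "\<dots> = h" using g h by simp
  finally show ?thesis .
qed

text \<open>Uniqueness of inverses makes the \<open>THE\<close> in \<open>inv_arr\<close>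
  denote.\<close>

lemma inverse_inv_arr: "is_iso B f \<Longrightarrow> inverse_arrows B f (inv_arr B f)"
  unfolding is_iso_def inv_arr_def using inverse_arrows_unique by (metis theI)

lemma inv_arr_simps [simp]:
  assumes "is_iso B f"
  shows "f \<in> Arr B" "inv_arr B f \<in> Arr B" "Dom B (inv_arr B f) = Cod B f"
    "Cod B (inv_arr B f) = Dom B f"
    "inv_arr B f \<cdot> f = iden B (Dom B f)" "f \<cdot> inv_arr B f = iden B (Cod B f)"
  using inverse_inv_arr[OF assms] by (auto simp: inverse_arrows_def in_hom_iff)

lemma inv_arr_cancel [simp]:
  assumes "is_iso B f" "g \<in> Arr B"
  shows "Cod B g = Dom B f \<Longrightarrow> inv_arr B f \<cdot> f \<cdot> g = g"
    and "Cod B g = Cod B f \<Longrightarrow> f \<cdot> inv_arr B f \<cdot> g = g"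
  using assms by (simp_all add: comp_assoc'[symmetric] del: comp_assoc')

lemma is_isoI:
  assumes "f \<in> Arr B" "g \<in> Arr B" "Dom B g = Cod B f" "Cod B g = Dom B f"
    "g \<cdot> f = iden B (Dom B f)" "f \<cdot> g = iden B (Cod B f)"
  shows "is_iso B f"
  unfolding is_iso_def inverse_arrows_def in_hom_iff using assms by blast

lemma is_iso_iden [simp]: "X \<in> Obj B \<Longrightarrow> is_iso B (iden B X)"
  by (rule is_isoI[of _ "iden B X"]) simp_all

lemma is_iso_comp [simp]:
  assumes "is_iso B f" "is_iso B g" "Cod B f = Dom B g"
  shows "is_iso B (g \<cdot> f)"
  by (rule is_isoI[of _ "inv_arr B f \<cdot> inv_arr B g"]) (use assms in simp_all)

lemma is_iso_inv_arr: "is_iso B f \<Longrightarrow> is_iso B (inv_arr B f)"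
  by (rule is_isoI[of _ f]) simp_all

lemma iso_epi:
  assumes "is_iso B e" "f \<in> Arr B" "g \<in> Arr B" "Dom B f = Cod B e" "Dom B g = Cod B e"
    "f \<cdot> e = g \<cdot> e"
  shows "f = g"
proof -
  have "f = (f \<cdot> e) \<cdot> inv_arr B e" using assms(1,2,4) by simp
  also have "\<dots> = g" using assms(1,3,5) by (simp add: assms(6))
  finally show ?thesis .
qed

lemma iso_mono:
  assumes "is_iso B e" "f \<in> Arr B" "g \<in> Arr B" "Cod B f = Dom B e" "Cod B g = Dom B e"
    "e \<cdot> f = e \<cdot> g"
  shows "f = g"
proof -
  have "f = inv_arr B e \<cdot> e \<cdot> f" using assms(1,2,4) by simp
  also have "\<dots> = g" using assms(1,3,5) by (simp add: assms(6))
  finally show ?thesis .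
qed

end

section \<open>Coherence\<close>

context monoidal_category
begin

declare tunit_Obj [simp] tobj_Obj [simp] assoc_iso [simp] lunit_iso [simp] runit_iso [simp]
  tarr_iden [simp]

lemma tarr_simps [simp]:
  assumes "f \<in> Arr B" "g \<in> Arr B"
  shows "f \<star> g \<in> Arr B" "Dom B (f \<star> g) = Dom B f \<otimes> Dom B g"
    "Cod B (f \<star> g) = Cod B f \<otimes> Cod B g"
  using tarr_hom[of f "Dom B f" "Cod B f" g "Dom B g" "Cod B g"] assms
  by (simp_all add: in_hom_iff)

lemma constraint_simps [simp]:
  assumes "X \<in> Obj B"
  shows "Dom B (lunit B X) = \<I> \<otimes> X" "Cod B (lunit B X) = X"
    "Dom B (runit B X) = X \<otimes> \<I>" "Cod B (runit B X) = X"
    "\<lbrakk>Y \<in> Obj B; Z \<in> Obj B\<rbrakk> \<Longrightarrow> Dom B (assoc B X Y Z) = (X \<otimes> Y) \<otimes> Z"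
    "\<lbrakk>Y \<in> Obj B; Z \<in> Obj B\<rbrakk> \<Longrightarrow> Cod B (assoc B X Y Z) = X \<otimes> (Y \<otimes> Z)"
  using lunit_hom[OF assms] runit_hom[OF assms] assoc_hom[OF assms] by (auto simp: in_hom_iff)

lemma tarr_comp:
  assumes "f \<in> Arr B" "g \<in> Arr B" "f' \<in> Arr B" "g' \<in> Arr B"
    "Cod B f = Dom B g" "Cod B f' = Dom B g'"
  shows "(g \<star> g') \<cdot> (f \<star> f') = (g \<cdot> f) \<star> (g' \<cdot> f')"
  using interchange[of f "Dom B f" "Cod B f" g "Cod B g" f' "Dom B f'" "Cod B f'" g' "Cod B g'"]
    assms by (simp add: in_hom_iff)

lemma tarr_comp_assoc:
  assumes "f \<in> Arr B" "g \<in> Arr B" "f' \<in> Arr B" "g' \<in> Arr B" "h \<in> Arr B"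
    "Cod B f = Dom B g" "Cod B f' = Dom B g'" "Cod B h = Dom B f \<otimes> Dom B f'"
  shows "(g \<star> g') \<cdot> (f \<star> f') \<cdot> h = ((g \<cdot> f) \<star> (g' \<cdot> f')) \<cdot> h"
  using assms by (subst comp_assoc'[symmetric]) (simp_all add: tarr_comp)

lemma is_iso_tarr [simp]:
  assumes "is_iso B f" "is_iso B g"
  shows "is_iso B (f \<star> g)"
  by (rule is_isoI[of _ "inv_arr B f \<star> inv_arr B g"]) (use assms in \<open>simp_all add: tarr_comp\<close>)

lemma assoc_nat:
  assumes "f \<in> Arr B" "g \<in> Arr B" "h \<in> Arr B" "X = Cod B f" "Y = Cod B g" "Z = Cod B h"
  shows "assoc B X Y Z \<cdot> ((f \<star> g) \<star> h)
       = (f \<star> (g \<star> h)) \<cdot> assoc B (Dom B f) (Dom B g) (Dom B h)"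
  using assoc_natural[of f "Dom B f" "Cod B f" g "Dom B g" "Cod B g" h "Dom B h" "Cod B h"]
    assms by (simp add: in_hom_iff)

lemma lunit_nat: "f \<in> Arr B \<Longrightarrow> lunit B (Cod B f) \<cdot> (iden B \<I> \<star> f) = f \<cdot> lunit B (Dom B f)"
  using lunit_natural[of f "Dom B f" "Cod B f"] by (simp add: in_hom_iff)

lemma runit_nat: "f \<in> Arr B \<Longrightarrow> runit B (Cod B f) \<cdot> (f \<star> iden B \<I>) = f \<cdot> runit B (Dom B f)"
  using runit_natural[of f "Dom B f" "Cod B f"] by (simp add: in_hom_iff)

text \<open>Naturality of the left unitor makes \<open>f\<close> a conjugate of
  \<open>iden B \<I> \<star> f\<close>, so tensoring with the unit loses nothing.\<close>

lemma tensor_unit_faithful_left: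
  assumes "f \<in> Arr B" "g \<in> Arr B" "Dom B f = Dom B g" "Cod B f = Cod B g"
    "iden B \<I> \<star> f = iden B \<I> \<star> g"
  shows "f = g"
  by (rule iso_epi[of "lunit B (Dom B f)"]) (use assms lunit_nat[of f] lunit_nat[of g] in auto)

lemma tensor_unit_faithful_right:
  assumes "f \<in> Arr B" "g \<in> Arr B" "Dom B f = Dom B g" "Cod B f = Cod B g"
    "f \<star> iden B \<I> = g \<star> iden B \<I>"
  shows "f = g"
  by (rule iso_epi[of "runit B (Dom B f)"]) (use assms runit_nat[of f] runit_nat[of g] in auto)

text \<open>Kelly's argument: after tensoring with \<open>\<I>\<close> the identity follows from the pentagon, the
  triangle and naturality.\<close>

lemma lunit_tobj:
  assumes [simp]: "X \<in> Obj B" "Y \<in> Obj B"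
  shows "lunit B (X \<otimes> Y) \<cdot> assoc B \<I> X Y = lunit B X \<star> iden B Y"
proof (rule tensor_unit_faithful_left)
  \<comment> \<open>The part of the pentagon for \<I>, \<I>, X, Y that precedes
    \<open>iden B \<I> \<star> assoc B \<I> X Y\<close>; it is invertible and can be cancelled at
    the end.\<close>
  let ?a = "assoc B \<I> (\<I> \<otimes> X) Y \<cdot> (assoc B \<I> \<I> X \<star> iden B Y)"
  show "iden B \<I> \<star> (lunit B (X \<otimes> Y) \<cdot> assoc B \<I> X Y) = iden B \<I> \<star> (lunit B X \<star> iden B Y)"
  proof (rule iso_epi[of ?a])
    have "(iden B \<I> \<star> (lunit B (X \<otimes> Y) \<cdot> assoc B \<I> X Y)) \<cdot> ?a
        = (iden B \<I> \<star> lunit B (X \<otimes> Y)) \<cdot> (iden B \<I> \<star> assoc B \<I> X Y) \<cdot> ?a"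
      by (simp add: tarr_comp_assoc)
    also have "\<dots> = ((iden B \<I> \<star> lunit B (X \<otimes> Y)) \<cdot> assoc B \<I> \<I> (X \<otimes> Y)) \<cdot> assoc B (\<I> \<otimes> \<I>) X Y"
      by (simp add: pentagon)
    also have "\<dots> = (runit B \<I> \<star> (iden B X \<star> iden B Y)) \<cdot> assoc B (\<I> \<otimes> \<I>) X Y"
      by (simp del: comp_assoc' add: triangle)
    also have "\<dots> = assoc B \<I> X Y \<cdot> ((runit B \<I> \<star> iden B X) \<star> iden B Y)"
      by (subst assoc_nat) (simp_all del: tarr_iden)
    also have "\<dots> = assoc B \<I> X Y \<cdot> ((iden B \<I> \<star> lunit B X) \<star> iden B Y) \<cdot> (assoc B \<I> \<I> X \<star> iden B Y)"
      by (simp add: tarr_comp triangle)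
    also have "\<dots> = (assoc B \<I> X Y \<cdot> ((iden B \<I> \<star> lunit B X) \<star> iden B Y)) \<cdot> (assoc B \<I> \<I> X \<star> iden B Y)"
      by simp
    also have "\<dots> = (iden B \<I> \<star> (lunit B X \<star> iden B Y)) \<cdot> ?a"
      by (subst assoc_nat) simp_all
    finally show "(iden B \<I> \<star> (lunit B (X \<otimes> Y) \<cdot> assoc B \<I> X Y)) \<cdot> ?a
        = (iden B \<I> \<star> (lunit B X \<star> iden B Y)) \<cdot> ?a" .
  qed simp_all
qed simp_all

text \<open>The mirror argument, with the pentagon for X, Y, \<I>, \<I>; the two sides are compared
  after applying \<open>assoc B X Y \<I>\<close>.\<close>

lemma runit_tobj:
  assumes [simp]: "X \<in> Obj B" "Y \<in> Obj B"
  shows "(iden B X \<star> runit B Y) \<cdot> assoc B X Y \<I> = runit B (X \<otimes> Y)"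
proof (rule tensor_unit_faithful_right)
  show "((iden B X \<star> runit B Y) \<cdot> assoc B X Y \<I>) \<star> iden B \<I> = runit B (X \<otimes> Y) \<star> iden B \<I>"
  proof (rule iso_mono[of "assoc B X Y \<I>"])
    have "assoc B X Y \<I> \<cdot> (((iden B X \<star> runit B Y) \<cdot> assoc B X Y \<I>) \<star> iden B \<I>)
        = (assoc B X Y \<I> \<cdot> ((iden B X \<star> runit B Y) \<star> iden B \<I>)) \<cdot> (assoc B X Y \<I> \<star> iden B \<I>)"
      by (simp add: tarr_comp)
    also have "\<dots> = (iden B X \<star> (runit B Y \<star> iden B \<I>)) \<cdot> assoc B X (Y \<otimes> \<I>) \<I> \<cdot> (assoc B X Y \<I> \<star> iden B \<I>)"
      by (subst assoc_nat) simp_all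
    also have "\<dots> = (iden B X \<star> (iden B Y \<star> lunit B \<I>)) \<cdot> (iden B X \<star> assoc B Y \<I> \<I>)
        \<cdot> assoc B X (Y \<otimes> \<I>) \<I> \<cdot> (assoc B X Y \<I> \<star> iden B \<I>)"
      by (simp add: tarr_comp_assoc triangle)
    also have "\<dots> = ((iden B X \<star> (iden B Y \<star> lunit B \<I>)) \<cdot> assoc B X Y (\<I> \<otimes> \<I>)) \<cdot> assoc B (X \<otimes> Y) \<I> \<I>"
      by (simp add: pentagon)
    also have "\<dots> = (assoc B X Y \<I> \<cdot> ((iden B X \<star> iden B Y) \<star> lunit B \<I>)) \<cdot> assoc B (X \<otimes> Y) \<I> \<I>"
      by (subst assoc_nat) (simp_all del: tarr_iden)
    also have "\<dots> = assoc B X Y \<I> \<cdot> (runit B (X \<otimes> Y) \<star> iden B \<I>)"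
      by (simp add: triangle)
    finally show "assoc B X Y \<I> \<cdot> (((iden B X \<star> runit B Y) \<cdot> assoc B X Y \<I>) \<star> iden B \<I>)
        = assoc B X Y \<I> \<cdot> (runit B (X \<otimes> Y) \<star> iden B \<I>)" .
  qed simp_all
qed simp_all

text \<open>Naturality of the left unitor at \<open>lunit B \<I>\<close> itself identifies
  \<open>lunit B (\<I> \<otimes> \<I>)\<close>; then \<open>lunit_tobj\<close> and the triangle show
  that both unitors agree after tensoring with \<I>.\<close>

lemma lunit_tunit: "lunit B \<I> = runit B \<I>"
proof -
  have "lunit B (\<I> \<otimes> \<I>) = iden B \<I> \<star> lunit B \<I>"
    using lunit_nat[of "lunit B \<I>"]
    by (intro iso_mono[of "lunit B \<I>" "lunit B (\<I> \<otimes> \<I>)"]) simp_all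
  then have *: "lunit B \<I> \<star> iden B \<I> = (iden B \<I> \<star> lunit B \<I>) \<cdot> assoc B \<I> \<I> \<I>"
    using lunit_tobj[of \<I> \<I>] by simp
  show ?thesis
    by (rule tensor_unit_faithful_right) (simp_all add: * triangle)
qed

section \<open>Canonical isomorphisms between tensor products of words\<close>

lemma tens_Cons: "xs \<noteq> [] \<Longrightarrow> tens B (X # xs) = X \<otimes> tens B xs"
  by (cases xs) simp_all

lemma merge_Cons: "xs \<noteq> [] \<Longrightarrow>
    merge B (X # xs) ys = (iden B X \<star> merge B xs ys) \<cdot> assoc B X (tens B xs) (tens B ys)"
  by (cases xs) simp_all

lemma tens_Obj [simp]: "set xs \<subseteq> Obj B \<Longrightarrow> tens B xs \<in> Obj B"
  by (induction xs rule: induct_list012) auto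

lemma merge_iso_hom:
  "set xs \<subseteq> Obj B \<Longrightarrow> set ys \<subseteq> Obj B \<Longrightarrow> is_iso B (merge B xs ys)
     \<and> Dom B (merge B xs ys) = tens B xs \<otimes> tens B ys \<and> Cod B (merge B xs ys) = tens B (xs @ ys)"
proof (induction xs)
  case (Cons X xs)
  show ?case
  proof (cases "xs = []")
    case True
    with Cons.prems show ?thesis by (cases ys) simp_all
  next
    case False
    with Cons show ?thesis by (simp add: tens_Cons merge_Cons)
  qed
qed simp

lemma merge_simps [simp]:
  assumes "set xs \<subseteq> Obj B" "set ys \<subseteq> Obj B"
  shows "is_iso B (merge B xs ys)" "merge B xs ys \<in> Arr B"
    "Dom B (merge B xs ys) = tens B xs \<otimes> tens B ys" "Cod B (merge B xs ys) = tens B (xs @ ys)"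
  using merge_iso_hom[OF assms] by simp_all

text \<open>On an empty left word \<open>merge\<close> is a unitor by definition. On the right this
  rests on \<open>runit_tobj\<close>, and on the equality of the two unitors at \<I> when both words
  are empty.\<close>

lemma merge_Nil_right: "set xs \<subseteq> Obj B \<Longrightarrow> merge B xs [] = runit B (tens B xs)"
proof (induction xs)
  case (Cons X xs)
  then show ?case
    by (cases "xs = []") (simp_all add: tens_Cons merge_Cons runit_tobj)
qed (simp add: lunit_tunit)

text \<open>The cocycle condition for \<open>merge\<close>, the coherence behind associativity of
  \<open>\<boxtimes>\<close> and the hexagons for words. Adding a letter to the left word is the
  pentagon; the empty word is \<open>lunit_tobj\<close>.\<close>

lemma merge_assoc:
  assumes "set xs \<subseteq> Obj B" and [simp]: "set ys \<subseteq> Obj B" "set zs \<subseteq> Obj B"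
  shows "merge B (xs @ ys) zs \<cdot> (merge B xs ys \<star> iden B (tens B zs))
       = merge B xs (ys @ zs) \<cdot> (iden B (tens B xs) \<star> merge B ys zs)
           \<cdot> assoc B (tens B xs) (tens B ys) (tens B zs)"
  using assms(1)
proof (induction xs)
  case Nil
  have "lunit B (tens B (ys @ zs)) \<cdot> (iden B \<I> \<star> merge B ys zs)
      \<cdot> assoc B \<I> (tens B ys) (tens B zs)
    = (lunit B (Cod B (merge B ys zs)) \<cdot> (iden B \<I> \<star> merge B ys zs))
      \<cdot> assoc B \<I> (tens B ys) (tens B zs)"
    by simp
  also have "\<dots> = merge B ys zs \<cdot> lunit B (tens B ys \<otimes> tens B zs)
      \<cdot> assoc B \<I> (tens B ys) (tens B zs)"
    by (subst lunit_nat) simp_all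
  finally show ?case by (simp add: lunit_tobj)
next
  case (Cons X xs)
  then have [simp]: "X \<in> Obj B" "set xs \<subseteq> Obj B" by auto
  let ?X = "iden B X" and ?x = "tens B xs" and ?y = "tens B ys" and ?z = "tens B zs"
  show ?case
  proof (cases "xs = []")
    case True
    show ?thesis
    \<comment> \<open>On a one-letter word \<open>merge\<close> is a unitor or an identity according
      to the second word; the triangle enters when \<open>ys\<close> is empty.\<close>
    proof (cases "ys = []")
      case True
      with \<open>xs = []\<close> assms(3) show ?thesis
        by (cases zs) (simp_all add: triangle)
    next
      case False
      with \<open>xs = []\<close> assms(2) show ?thesis
        by (cases ys) (simp_all add: merge_Cons)
    qed
  next
    case False
    have "merge B ((X # xs) @ ys) zs \<cdot> (merge B (X # xs) ys \<star> iden B ?z)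
        = (?X \<star> merge B (xs @ ys) zs) \<cdot> (assoc B X (tens B (xs @ ys)) ?z
           \<cdot> ((?X \<star> merge B xs ys) \<star> iden B ?z)) \<cdot> (assoc B X ?x ?y \<star> iden B ?z)"
      using False by (simp add: merge_Cons tens_Cons tarr_comp)
    also have "\<dots> = (?X \<star> (merge B (xs @ ys) zs \<cdot> (merge B xs ys \<star> iden B ?z)))
        \<cdot> assoc B X (?x \<otimes> ?y) ?z \<cdot> (assoc B X ?x ?y \<star> iden B ?z)"
      by (subst assoc_nat) (simp_all add: tarr_comp_assoc)
    also have "\<dots> = (?X \<star> merge B xs (ys @ zs)) \<cdot> (?X \<star> (iden B ?x \<star> merge B ys zs))
        \<cdot> (?X \<star> assoc B ?x ?y ?z) \<cdot> assoc B X (?x \<otimes> ?y) ?z \<cdot> (assoc B X ?x ?y \<star> iden B ?z)"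
      by (simp add: Cons.IH tarr_comp_assoc)
    also have "\<dots> = (?X \<star> merge B xs (ys @ zs)) \<cdot> ((?X \<star> (iden B ?x \<star> merge B ys zs))
        \<cdot> assoc B X ?x (?y \<otimes> ?z)) \<cdot> assoc B (X \<otimes> ?x) ?y ?z"
      by (simp add: pentagon)
    also have "\<dots> = (?X \<star> merge B xs (ys @ zs)) \<cdot> (assoc B X ?x (tens B (ys @ zs))
        \<cdot> ((?X \<star> iden B ?x) \<star> merge B ys zs)) \<cdot> assoc B (X \<otimes> ?x) ?y ?z"
      by (subst assoc_nat) (simp_all del: tarr_iden)
    finally show ?thesis using False by (simp add: merge_Cons tens_Cons)
  qed
qed

end

section \<open>The strictification\<close>

context monoidal_category
begin

text \<open>\<open>Warr\<close> imposes no relation between its arrow and its two words; this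
  predicate supplies the typing under which the strict laws hold.\<close>

definition war :: "('a, 'b) warr \<Rightarrow> bool" where
  "war f \<longleftrightarrow> set (wdom f) \<subseteq> Obj B \<and> set (wcod f) \<subseteq> Obj B
     \<and> und f \<in> hom B (tens B (wdom f)) (tens B (wcod f))"

lemma war_simps [simp]:
  assumes "war f"
  shows "set (wdom f) \<subseteq> Obj B" "set (wcod f) \<subseteq> Obj B" "und f \<in> Arr B"
    "Dom B (und f) = tens B (wdom f)" "Cod B (und f) = tens B (wcod f)"
  using assms by (simp_all add: war_def in_hom_iff)

lemma warI:
  assumes "set (wdom f) \<subseteq> Obj B" "set (wcod f) \<subseteq> Obj B" "und f \<in> Arr B"
    "Dom B (und f) = tens B (wdom f)" "Cod B (und f) = tens B (wcod f)"
  shows "war f"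
  unfolding war_def in_hom_iff using assms by blast

lemma wcomp_simps [simp]: "wdom (g \<bullet> f) = wdom f" "wcod (g \<bullet> f) = wcod g"
  "und (g \<bullet> f) = und g \<cdot> und f"
  by (simp_all add: wcomp_def)

lemma wid_simps [simp]: "wdom (wid B xs) = xs" "wcod (wid B xs) = xs"
  "und (wid B xs) = iden B (tens B xs)"
  by (simp_all add: wid_def)

lemma wtens_simps [simp]: "wdom (f \<boxtimes> g) = wdom f @ wdom g" "wcod (f \<boxtimes> g) = wcod f @ wcod g"
  by (simp_all add: wtens_def)

lemma war_wid [simp]: "set xs \<subseteq> Obj B \<Longrightarrow> war (wid B xs)"
  by (rule warI) simp_all

lemma war_wcomp [simp]: "war f \<Longrightarrow> war g \<Longrightarrow> wcod f = wdom g \<Longrightarrow> war (g \<bullet> f)"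
  by (rule warI) simp_all

lemma war_wtens [simp]: "war f \<Longrightarrow> war g \<Longrightarrow> war (f \<boxtimes> g)"
  by (rule warI) (simp_all add: wtens_def)

lemma warr_eq_iff: "f = g \<longleftrightarrow> wdom f = wdom g \<and> wcod f = wcod g \<and> und f = und g"
  by (cases f; cases g) auto

lemma wcomp_assoc [simp]:
  assumes "war f" "war g" "war h" "wcod f = wdom g" "wcod g = wdom h"
  shows "(h \<bullet> g) \<bullet> f = h \<bullet> g \<bullet> f"
  using assms by (simp add: wcomp_def)

lemma wcomp_wid [simp]:
  assumes "war f"
  shows "xs = wcod f \<Longrightarrow> wid B xs \<bullet> f = f" "xs = wdom f \<Longrightarrow> f \<bullet> wid B xs = f"
  using assms by (simp_all add: warr_eq_iff)

text \<open>The defining conjugation with its inverse moved across, so that calculations can carry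
  \<open>merge\<close> along instead of inverting it.\<close>

lemma und_wtens_merge:
  assumes "war f" "war g" "xs = wdom f" "ys = wdom g"
  shows "und (f \<boxtimes> g) \<cdot> merge B xs ys = merge B (wcod f) (wcod g) \<cdot> (und f \<star> und g)"
  using assms by (simp add: wtens_def)

lemma und_wtens_merge_assoc:
  assumes "war f" "war g" "xs = wdom f" "ys = wdom g" "h \<in> Arr B" "Cod B h = tens B xs \<otimes> tens B ys"
  shows "und (f \<boxtimes> g) \<cdot> merge B xs ys \<cdot> h = merge B (wcod f) (wcod g) \<cdot> (und f \<star> und g) \<cdot> h"
  using assms by (simp add: wtens_def)

lemma wtens_comp:
  assumes "war f" "war g" "war f'" "war g'" "wcod f = wdom g" "wcod f' = wdom g'"
  shows "(g \<boxtimes> g') \<bullet> (f \<boxtimes> f') = (g \<bullet> f) \<boxtimes> (g' \<bullet> f')"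
  using assms by (simp add: warr_eq_iff wtens_def tarr_comp_assoc)

lemma wtens_wid [simp]:
  assumes "set xs \<subseteq> Obj B" "set ys \<subseteq> Obj B"
  shows "wid B xs \<boxtimes> wid B ys = wid B (xs @ ys)"
  using assms by (simp add: warr_eq_iff wtens_def)

text \<open>After precomposition with a merge of all three domains, the two bracketings differ by an
  associator, which passes the underlying arrows by naturality and is absorbed by
  \<open>merge_assoc\<close> at both ends.\<close>

lemma wtens_assoc [simp]:
  assumes [simp]: "war f" "war g" "war h"
  shows "(f \<boxtimes> g) \<boxtimes> h = f \<boxtimes> g \<boxtimes> h"
proof -
  let ?dm = "merge B (wdom f @ wdom g) (wdom h) \<cdot> (merge B (wdom f) (wdom g) \<star> iden B (tens B (wdom h)))"
  let ?a = "assoc B (tens B (wdom f)) (tens B (wdom g)) (tens B (wdom h))"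
    and ?b = "assoc B (tens B (wcod f)) (tens B (wcod g)) (tens B (wcod h))"
  have "und ((f \<boxtimes> g) \<boxtimes> h) = und (f \<boxtimes> g \<boxtimes> h)"
  proof (rule iso_epi[of ?dm])
    have "und ((f \<boxtimes> g) \<boxtimes> h) \<cdot> ?dm
        = merge B (wcod f @ wcod g) (wcod h) \<cdot> (und (f \<boxtimes> g) \<star> und h)
          \<cdot> (merge B (wdom f) (wdom g) \<star> iden B (tens B (wdom h)))"
      by (simp add: und_wtens_merge_assoc)
    also have "\<dots> = (merge B (wcod f @ wcod g) (wcod h) \<cdot> (merge B (wcod f) (wcod g) \<star> iden B (tens B (wcod h))))
          \<cdot> ((und f \<star> und g) \<star> und h)"
      by (simp add: tarr_comp und_wtens_merge)
    also have "\<dots> = merge B (wcod f) (wcod g @ wcod h)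
          \<cdot> (iden B (tens B (wcod f)) \<star> merge B (wcod g) (wcod h)) \<cdot> (?b \<cdot> ((und f \<star> und g) \<star> und h))"
      by (simp add: merge_assoc)
    also have "\<dots> = merge B (wcod f) (wcod g @ wcod h)
          \<cdot> (und f \<star> und (g \<boxtimes> h)) \<cdot> (iden B (tens B (wdom f)) \<star> merge B (wdom g) (wdom h)) \<cdot> ?a"
      by (subst assoc_nat) (simp_all add: tarr_comp_assoc und_wtens_merge)
    also have "\<dots> = und (f \<boxtimes> g \<boxtimes> h) \<cdot> merge B (wdom f) (wdom g @ wdom h)
          \<cdot> (iden B (tens B (wdom f)) \<star> merge B (wdom g) (wdom h)) \<cdot> ?a"
      by (simp add: und_wtens_merge_assoc)
    finally show "und ((f \<boxtimes> g) \<boxtimes> h) \<cdot> ?dm = und (f \<boxtimes> g \<boxtimes> h) \<cdot> ?dm"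
      by (simp add: merge_assoc)
  qed simp_all
  then show ?thesis by (simp add: warr_eq_iff)
qed

lemma wtens_unit [simp]:
  assumes "war f"
  shows "wid B [] \<boxtimes> f = f" "f \<boxtimes> wid B [] = f"
proof -
  have "lunit B (tens B (wcod f)) \<cdot> (iden B \<I> \<star> und f) \<cdot> inv_arr B (lunit B (tens B (wdom f)))
      = (und f \<cdot> lunit B (tens B (wdom f))) \<cdot> inv_arr B (lunit B (tens B (wdom f)))"
    "runit B (tens B (wcod f)) \<cdot> (und f \<star> iden B \<I>) \<cdot> inv_arr B (runit B (tens B (wdom f)))
      = (und f \<cdot> runit B (tens B (wdom f))) \<cdot> inv_arr B (runit B (tens B (wdom f)))"
    \<comment> \<open>The words are first rewritten to \<open>Dom\<close> and \<open>Cod\<close> of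
      the arrow, the form in which naturality of the unitors is stated.\<close>
    using assms by (simp_all only: lunit_nat[symmetric] runit_nat[symmetric] war_simps(3)
        war_simps(4,5)[symmetric]) simp_all
  then show "wid B [] \<boxtimes> f = f" "f \<boxtimes> wid B [] = f"
    using assms by (simp_all add: warr_eq_iff wtens_def merge_Nil_right)
qed

end

section \<open>Braidings of words\<close>

context braided_category
begin

declare braid_iso [simp]

lemma braid_simps [simp]:
  assumes "X \<in> Obj B" "Y \<in> Obj B"
  shows "Dom B (braid B X Y) = X \<otimes> Y" "Cod B (braid B X Y) = Y \<otimes> X"
  using braid_hom[OF assms] by (simp_all add: in_hom_iff)

lemma braid_nat:
  assumes "f \<in> Arr B" "g \<in> Arr B" "X = Cod B f" "Y = Cod B g"
  shows "braid B X Y \<cdot> (f \<star> g) = (g \<star> f) \<cdot> braid B (Dom B f) (Dom B g)"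
  using braid_natural[of f "Dom B f" "Cod B f" g "Dom B g" "Cod B g"] assms
  by (simp add: in_hom_iff)

lemma braid_nat_assoc:
  assumes "f \<in> Arr B" "g \<in> Arr B" "X = Cod B f" "Y = Cod B g" "h \<in> Arr B" "Cod B h = Dom B f \<otimes> Dom B g"
  shows "braid B X Y \<cdot> (f \<star> g) \<cdot> h = (g \<star> f) \<cdot> braid B (Dom B f) (Dom B g) \<cdot> h"
proof -
  have "braid B X Y \<cdot> (f \<star> g) \<cdot> h = (braid B X Y \<cdot> (f \<star> g)) \<cdot> h"
    using assms by simp
  then show ?thesis using assms by (simp add: braid_nat)
qed

lemma wbraid_simps [simp]: "wdom (wbraid B xs ys) = xs @ ys" "wcod (wbraid B xs ys) = ys @ xs"
  by (simp_all add: wbraid_def)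

lemma war_wbraid [simp]: "set xs \<subseteq> Obj B \<Longrightarrow> set ys \<subseteq> Obj B \<Longrightarrow> war (wbraid B xs ys)"
  by (rule warI) (simp_all add: wbraid_def)

lemma und_wbraid_merge:
  assumes "set xs \<subseteq> Obj B" "set ys \<subseteq> Obj B"
  shows "und (wbraid B xs ys) \<cdot> merge B xs ys = merge B ys xs \<cdot> braid B (tens B xs) (tens B ys)"
  using assms by (simp add: wbraid_def)

lemma und_wbraid_merge_assoc:
  assumes "set xs \<subseteq> Obj B" "set ys \<subseteq> Obj B" "h \<in> Arr B" "Cod B h = tens B xs \<otimes> tens B ys"
  shows "und (wbraid B xs ys) \<cdot> merge B xs ys \<cdot> h = merge B ys xs \<cdot> braid B (tens B xs) (tens B ys) \<cdot> h"
  using assms by (simp add: wbraid_def)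

lemma wbraid_natural:
  assumes "war f" "war g"
  shows "wbraid B (wcod f) (wcod g) \<bullet> (f \<boxtimes> g) = (g \<boxtimes> f) \<bullet> wbraid B (wdom f) (wdom g)"
  using assms by (simp add: warr_eq_iff wbraid_def wtens_def braid_nat_assoc)

text \<open>Precomposition with a merge of the three words reduces this to
  \<open>hexagon_right\<close>; \<open>merge_assoc\<close> absorbs the associators, which leaves the
  hexagon in its strict form.\<close>

lemma wbraid_append_right:
  assumes [simp]: "set xs \<subseteq> Obj B" "set ys \<subseteq> Obj B" "set zs \<subseteq> Obj B"
  shows "wbraid B xs (ys @ zs) = (wid B ys \<boxtimes> wbraid B xs zs) \<bullet> (wbraid B xs ys \<boxtimes> wid B zs)"
proof -
  let ?x = "tens B xs" and ?y = "tens B ys" and ?z = "tens B zs"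
  let ?e = "merge B (xs @ ys) zs \<cdot> (merge B xs ys \<star> iden B ?z)"
  have "und (wbraid B xs (ys @ zs)) = und ((wid B ys \<boxtimes> wbraid B xs zs) \<bullet> (wbraid B xs ys \<boxtimes> wid B zs))"
  proof (rule iso_epi[of ?e])
    have "und ((wid B ys \<boxtimes> wbraid B xs zs) \<bullet> (wbraid B xs ys \<boxtimes> wid B zs)) \<cdot> ?e
        = und (wid B ys \<boxtimes> wbraid B xs zs) \<cdot> (merge B (ys @ xs) zs \<cdot> (merge B ys xs \<star> iden B ?z))
            \<cdot> (braid B ?x ?y \<star> iden B ?z)"
      by (simp add: und_wtens_merge_assoc und_wbraid_merge tarr_comp)
    also have "\<dots> = merge B ys (zs @ xs) \<cdot> (iden B ?y \<star> merge B zs xs) \<cdot> (iden B ?y \<star> braid B ?x ?z)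
            \<cdot> assoc B ?y ?x ?z \<cdot> (braid B ?x ?y \<star> iden B ?z)"
      by (simp add: merge_assoc und_wtens_merge_assoc und_wbraid_merge tarr_comp_assoc)
    also have "\<dots> = (merge B ys (zs @ xs) \<cdot> (iden B ?y \<star> merge B zs xs) \<cdot> assoc B ?y ?z ?x)
            \<cdot> braid B ?x (?y \<otimes> ?z) \<cdot> assoc B ?x ?y ?z"
      by (simp add: hexagon_right)
    also have "\<dots> = (merge B (ys @ zs) xs \<cdot> (merge B ys zs \<star> iden B ?x))
            \<cdot> braid B ?x (?y \<otimes> ?z) \<cdot> assoc B ?x ?y ?z"
      by (simp only: merge_assoc assms)
    also have "\<dots> = und (wbraid B xs (ys @ zs)) \<cdot> merge B xs (ys @ zs)
            \<cdot> (iden B ?x \<star> merge B ys zs) \<cdot> assoc B ?x ?y ?z"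
      by (simp add: und_wbraid_merge_assoc braid_nat_assoc)
    finally show "und (wbraid B xs (ys @ zs)) \<cdot> ?e
        = und ((wid B ys \<boxtimes> wbraid B xs zs) \<bullet> (wbraid B xs ys \<boxtimes> wid B zs)) \<cdot> ?e"
      by (simp add: merge_assoc)
  qed simp_all
  then show ?thesis by (simp add: warr_eq_iff)
qed

text \<open>\<open>merge_assoc\<close> solved for the other bracketing, to match the inverse
  associators of \<open>hexagon_left\<close>.\<close>

lemma merge_assoc_inv:
  assumes [simp]: "set xs \<subseteq> Obj B" "set ys \<subseteq> Obj B" "set zs \<subseteq> Obj B"
  shows "merge B xs (ys @ zs) \<cdot> (iden B (tens B xs) \<star> merge B ys zs)
       = merge B (xs @ ys) zs \<cdot> (merge B xs ys \<star> iden B (tens B zs))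
           \<cdot> inv_arr B (assoc B (tens B xs) (tens B ys) (tens B zs))"
  by (rule iso_epi[of "assoc B (tens B xs) (tens B ys) (tens B zs)"])
    (simp_all add: merge_assoc)

lemma wbraid_append_left:
  assumes [simp]: "set xs \<subseteq> Obj B" "set ys \<subseteq> Obj B" "set zs \<subseteq> Obj B"
  shows "wbraid B (xs @ ys) zs = (wbraid B xs zs \<boxtimes> wid B ys) \<bullet> (wid B xs \<boxtimes> wbraid B ys zs)"
proof -
  let ?x = "tens B xs" and ?y = "tens B ys" and ?z = "tens B zs"
  let ?e = "merge B xs (ys @ zs) \<cdot> (iden B ?x \<star> merge B ys zs)"
  have "und (wbraid B (xs @ ys) zs) = und ((wbraid B xs zs \<boxtimes> wid B ys) \<bullet> (wid B xs \<boxtimes> wbraid B ys zs))"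
  proof (rule iso_epi[of ?e])
    have "und ((wbraid B xs zs \<boxtimes> wid B ys) \<bullet> (wid B xs \<boxtimes> wbraid B ys zs)) \<cdot> ?e
        = und (wbraid B xs zs \<boxtimes> wid B ys) \<cdot> (merge B xs (zs @ ys) \<cdot> (iden B ?x \<star> merge B zs ys))
            \<cdot> (iden B ?x \<star> braid B ?y ?z)"
      by (simp add: und_wtens_merge_assoc und_wbraid_merge tarr_comp)
    also have "\<dots> = merge B (zs @ xs) ys \<cdot> (merge B zs xs \<star> iden B ?y) \<cdot> (braid B ?x ?z \<star> iden B ?y)
            \<cdot> inv_arr B (assoc B ?x ?z ?y) \<cdot> (iden B ?x \<star> braid B ?y ?z)"
      by (simp add: merge_assoc_inv und_wtens_merge_assoc und_wbraid_merge tarr_comp_assoc)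
    also have "\<dots> = (merge B (zs @ xs) ys \<cdot> (merge B zs xs \<star> iden B ?y) \<cdot> inv_arr B (assoc B ?z ?x ?y))
            \<cdot> braid B (?x \<otimes> ?y) ?z \<cdot> inv_arr B (assoc B ?x ?y ?z)"
      by (simp add: hexagon_left)
    also have "\<dots> = (merge B zs (xs @ ys) \<cdot> (iden B ?z \<star> merge B xs ys))
            \<cdot> braid B (?x \<otimes> ?y) ?z \<cdot> inv_arr B (assoc B ?x ?y ?z)"
      by (simp only: merge_assoc_inv assms)
    also have "\<dots> = und (wbraid B (xs @ ys) zs) \<cdot> merge B (xs @ ys) zs
            \<cdot> (merge B xs ys \<star> iden B ?z) \<cdot> inv_arr B (assoc B ?x ?y ?z)"
      by (simp add: und_wbraid_merge_assoc braid_nat_assoc)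
    finally show "und (wbraid B (xs @ ys) zs) \<cdot> ?e
        = und ((wbraid B xs zs \<boxtimes> wid B ys) \<bullet> (wid B xs \<boxtimes> wbraid B ys zs)) \<cdot> ?e"
      by (simp add: merge_assoc_inv)
  qed simp_all
  then show ?thesis by (simp add: warr_eq_iff)
qed

text \<open>Both unit braidings are idempotent by a hexagon, and invertible.\<close>

lemma wbraid_Nil [simp]:
  assumes [simp]: "set xs \<subseteq> Obj B"
  shows "wbraid B xs [] = wid B xs" "wbraid B [] xs = wid B xs"
proof -
  have *: "f = iden B (Dom B f)" if "f \<cdot> f = f" "is_iso B f" "Dom B f = Cod B f" for f
    by (rule iso_mono[of f]) (use that in simp_all)
  have "is_iso B (und (wbraid B xs []))" "is_iso B (und (wbraid B [] xs))"
    by (simp_all add: wbraid_def is_iso_inv_arr)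
  moreover have "wbraid B xs [] = wbraid B xs [] \<bullet> wbraid B xs []"
    "wbraid B [] xs = wbraid B [] xs \<bullet> wbraid B [] xs"
    using wbraid_append_right[of xs "[]" "[]"] wbraid_append_left[of "[]" "[]" xs] by simp_all
  ultimately show "wbraid B xs [] = wid B xs" "wbraid B [] xs = wid B xs"
    using *[of "und (wbraid B xs [])"] *[of "und (wbraid B [] xs)"]
    by (simp_all add: warr_eq_iff)
qed

end

context twisted_category
begin

lemma wtwist_simps [simp]: "wdom (wtwist B xs) = xs" "wcod (wtwist B xs) = xs"
  by (simp_all add: wtwist_def)

lemma war_wtwist [simp]: "set xs \<subseteq> Obj B \<Longrightarrow> war (wtwist B xs)"
  using twist_hom[of "tens B xs"] by (intro warI) (simp_all add: wtwist_def in_hom_iff)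

end

section \<open>Whiskered layers\<close>

context monoidal_category
begin

text \<open>One layer of a string diagram. Keeping the idle strands as two lists turns the position
  of \<open>f\<close> into a list length, so that relative positions of layers can be decided by
  computation.\<close>

definition whisk :: "'a list \<Rightarrow> ('a, 'b) warr \<Rightarrow> 'a list \<Rightarrow> ('a, 'b) warr" where
  "whisk xs f ys = wid B xs \<boxtimes> f \<boxtimes> wid B ys"

lemma whisk_simps [simp]: "wdom (whisk xs f ys) = xs @ wdom f @ ys"
    "wcod (whisk xs f ys) = xs @ wcod f @ ys"
  by (simp_all add: whisk_def)

lemma war_whisk [simp]:
  "war f \<Longrightarrow> set xs \<subseteq> Obj B \<Longrightarrow> set ys \<subseteq> Obj B \<Longrightarrow> war (whisk xs f ys)"
  by (simp add: whisk_def)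

lemma whisk_wcomp:
  assumes "war f" "war g" "wcod f = wdom g" "set xs \<subseteq> Obj B" "set ys \<subseteq> Obj B"
  shows "whisk xs (g \<bullet> f) ys = whisk xs g ys \<bullet> whisk xs f ys"
  using assms by (simp add: whisk_def wtens_comp)

lemma whisk_wid:
  assumes "set xs \<subseteq> Obj B" "set ys \<subseteq> Obj B" "set zs \<subseteq> Obj B"
  shows "whisk xs (wid B zs) ys = wid B (xs @ zs @ ys)"
  using assms by (simp add: whisk_def)

lemma whisk_whisk:
  assumes "war f" "set xs \<subseteq> Obj B" "set ys \<subseteq> Obj B" "set xs' \<subseteq> Obj B" "set ys' \<subseteq> Obj B"
  shows "whisk xs (whisk xs' f ys') ys = whisk (xs @ xs') f (ys' @ ys)"
proof -
  have "whisk xs (whisk xs' f ys') ys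
      = (wid B xs \<boxtimes> wid B xs') \<boxtimes> f \<boxtimes> (wid B ys' \<boxtimes> wid B ys)"
    using assms by (simp add: whisk_def del: wtens_wid)
  then show ?thesis using assms by (simp add: whisk_def)
qed

lemma wtens_whisk:
  assumes "war f" "war g"
  shows "f \<boxtimes> g = whisk [] f (wcod g) \<bullet> whisk (wdom f) g []"
  using assms by (simp add: whisk_def wtens_comp)

lemma whisk_wtens:
  assumes "war f" "war g" "set xs \<subseteq> Obj B" "set ys \<subseteq> Obj B"
  shows "whisk xs (f \<boxtimes> g) ys = whisk xs f (wcod g @ ys) \<bullet> whisk (xs @ wdom f) g ys"
  using assms by (simp add: wtens_whisk whisk_wcomp whisk_whisk)

lemma whisk_interchange:
  assumes "war f" "war g" "set xs \<subseteq> Obj B" "set ys \<subseteq> Obj B" "set zs \<subseteq> Obj B"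
  shows "whisk (xs @ wcod f @ ys) g zs \<bullet> whisk xs f (ys @ wdom g @ zs)
       = whisk xs f (ys @ wcod g @ zs) \<bullet> whisk (xs @ wdom f @ ys) g zs"
proof -
  have "whisk (wcod f @ ys) g [] \<bullet> whisk [] f (ys @ wdom g)
      = whisk [] f (ys @ wcod g) \<bullet> whisk (wdom f @ ys) g []"
    using assms by (simp add: whisk_def wtens_comp flip: wtens_wid)
  then have "whisk xs (whisk (wcod f @ ys) g [] \<bullet> whisk [] f (ys @ wdom g)) zs
      = whisk xs (whisk [] f (ys @ wcod g) \<bullet> whisk (wdom f @ ys) g []) zs"
    by simp
  then show ?thesis using assms by (simp add: whisk_wcomp whisk_whisk)
qed

text \<open>\<open>whisk_interchange\<close> as a rewrite rule. The gap between the two arrows is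
  computed by \<open>drop\<close>, since matching cannot find how a concrete word splits as an
  append; the side conditions then check that \<open>g\<close> lies to the right of
  \<open>f\<close>.\<close>

lemma whisk_swap:
  assumes "length xs + length (wcod f) \<le> length xs'"
    "xs' = xs @ wcod f @ drop (length xs + length (wcod f)) xs'"
    "ys = drop (length xs + length (wcod f)) xs' @ wdom g @ ys'"
    "war f" "war g" "set xs' \<subseteq> Obj B" "set ys' \<subseteq> Obj B"
  shows "whisk xs' g ys' \<bullet> whisk xs f ys
       = whisk xs f (drop (length xs + length (wcod f)) xs' @ wcod g @ ys')
           \<bullet> whisk (xs @ wdom f @ drop (length xs + length (wcod f)) xs') g ys'"
proof -
  define zs where "zs = drop (length xs + length (wcod f)) xs'"
  have e: "xs' = xs @ wcod f @ zs" "ys = zs @ wdom g @ ys'"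
    using assms unfolding zs_def by auto
  then show ?thesis
    unfolding zs_def[symmetric] using assms(4-7) e
    by (simp add: whisk_interchange)
qed

lemma whisk_swap_assoc:
  assumes "length xs + length (wcod f) \<le> length xs'"
    "xs' = xs @ wcod f @ drop (length xs + length (wcod f)) xs'"
    "ys = drop (length xs + length (wcod f)) xs' @ wdom g @ ys'"
    "war f" "war g" "set xs' \<subseteq> Obj B" "set ys' \<subseteq> Obj B" "war h" "wcod h = xs @ wdom f @ ys"
  shows "whisk xs' g ys' \<bullet> whisk xs f ys \<bullet> h
       = whisk xs f (drop (length xs + length (wcod f)) xs' @ wcod g @ ys')
           \<bullet> whisk (xs @ wdom f @ drop (length xs + length (wcod f)) xs') g ys' \<bullet> h"
proof -
  define zs where "zs = drop (length xs + length (wcod f)) xs'"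
  have e: "xs' = xs @ wcod f @ zs" "ys = zs @ wdom g @ ys'"
    using assms unfolding zs_def by auto
  have "whisk xs' g ys' \<bullet> whisk xs f ys \<bullet> h = (whisk xs' g ys' \<bullet> whisk xs f ys) \<bullet> h"
    using assms(4-) e by simp
  also have "\<dots> = (whisk xs f (zs @ wcod g @ ys') \<bullet> whisk (xs @ wdom f @ zs) g ys') \<bullet> h"
    by (subst whisk_swap) (use assms in \<open>simp_all add: zs_def\<close>)
  finally show ?thesis
    unfolding zs_def[symmetric] using assms(4-) e by simp
qed

text \<open>The trivial whiskering starts the normalisation: the rules in \<open>layers\<close> push
  \<open>whisk\<close> inwards and do not act on a bare \<open>\<boxtimes>\<close>.\<close>

lemma whisk_eqI:
  assumes "war f" "war g" "whisk [] f [] = whisk [] g []"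
  shows "f = g"
  using assms by (simp add: whisk_def)

lemma set_replicate_subset [simp]: "X \<in> Obj B \<Longrightarrow> set (replicate n X) \<subseteq> Obj B"
  by auto

text \<open>Normal form of a composite of layers: independent layers are ordered so that the one
  further to the right is applied first.\<close>

lemmas layers = whisk_wcomp whisk_wid whisk_whisk whisk_wtens whisk_swap whisk_swap_assoc
  replicate_app_Cons_same replicate_add

end

section \<open>Action of \<open>H\<^sup>\<otimes>\<^sup>n\<close> on a module coalgebra\<close>

context braided_category
begin

lemma wbraid_natural_left: "war f \<Longrightarrow> set ys \<subseteq> Obj B \<Longrightarrow>
    wbraid B (wcod f) ys \<bullet> (f \<boxtimes> wid B ys) = (wid B ys \<boxtimes> f) \<bullet> wbraid B (wdom f) ys"
  using wbraid_natural[of f "wid B ys"] by simp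

lemma wbraid_natural_right: "war f \<Longrightarrow> set xs \<subseteq> Obj B \<Longrightarrow>
    wbraid B xs (wcod f) \<bullet> (wid B xs \<boxtimes> f) = (f \<boxtimes> wid B xs) \<bullet> wbraid B xs (wdom f)"
  using wbraid_natural[of "wid B xs" f] by simp

end

locale braided_module_coalgebra = braided_category B + module_coalgebra B H C
  for B :: "('o, 'm, 'z) braided_category_scheme" (structure)
    and H :: "('o, 'm, 'x) hopf_algebra_scheme"
    and C :: "('o, 'm, 'y) module_coalgebra_scheme"
begin

abbreviation "h \<equiv> ob H"
abbreviation "c \<equiv> ob C"
abbreviation "hs n \<equiv> replicate n h"
abbreviation "cs n \<equiv> replicate n c"
abbreviation "r \<equiv> wact H C"

lemma ob_in_Obj [simp]: "h \<in> Obj B" "c \<in> Obj B"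
  by (rule H.ob_Obj C.ob_Obj)+

lemma war_structure_maps [simp]: "war \<Delta>\<^bsub>H\<^esub>" "war \<epsilon>\<^bsub>H\<^esub>" "war \<mu>\<^bsub>H\<^esub>" "war \<eta>\<^bsub>H\<^esub>" "war \<S>\<^bsub>H\<^esub>"
  "war \<Delta>\<^bsub>C\<^esub>" "war \<epsilon>\<^bsub>C\<^esub>" "war r"
  using H.comult_hom H.counit_hom H.mult_hom H.unit_hom H.antipode_hom
    C.comult_hom C.counit_hom act_hom
  by (simp_all add: war_def in_hom_iff)

lemma wbraid_c_hs:
  "wbraid B [c] (h # hs n) = (wid B [h] \<boxtimes> wbraid B [c] (hs n)) \<bullet> (wbraid B [c] [h] \<boxtimes> wid B (hs n))"
  using wbraid_append_right[of "[c]" "[h]" "hs n"] by simp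

lemma wbraid_c_hh:
  "wbraid B [c] [h, h] = (wid B [h] \<boxtimes> wbraid B [c] [h]) \<bullet> (wbraid B [c] [h] \<boxtimes> wid B [h])"
  using wbraid_append_right[of "[c]" "[h]" "[h]"] by simp

lemma wbraid_cc:
  "wbraid B [c, c] [h] = (wbraid B [c] [h] \<boxtimes> wid B [c]) \<bullet> (wid B [c] \<boxtimes> wbraid B [c] [h])"
  using wbraid_append_left[of "[c]" "[c]" "[h]"] by simp

lemma wbraid_ch:
  "wbraid B [c, h] (hs n) = (wbraid B [c] (hs n) \<boxtimes> wid B [h]) \<bullet> (wid B [c] \<boxtimes> wbraid B [h] (hs n))"
  "wbraid B [c, h] [h] = (wbraid B [c] [h] \<boxtimes> wid B [h]) \<bullet> (wid B [c] \<boxtimes> wbraid B [h] [h])"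
  using wbraid_append_left[of "[c]" "[h]" "hs n"] wbraid_append_left[of "[c]" "[h]" "[h]"] by simp_all

text \<open>One copy of C is split off for each letter and acted upon at once, so no separate
  iterated comultiplication is carried along. The counit at 0 makes the splitting law and the
  formula for \<alpha> hold there too.\<close>

primrec iact :: "nat \<Rightarrow> ('o, 'm) warr" where
  "iact 0 = \<epsilon>\<^bsub>C\<^esub>"
| iact_Suc: "iact (Suc n) = (r \<boxtimes> iact n) \<bullet> (wid B [c] \<boxtimes> wbraid B [c] [h] \<boxtimes> wid B (hs n))
     \<bullet> (\<Delta>\<^bsub>C\<^esub> \<boxtimes> wid B (hs (Suc n)))"

lemma iact_simps [simp]: "wdom (iact n) = c # hs n" "wcod (iact n) = cs n"
  by (induction n) simp_all

lemma war_iact [simp]: "war (iact n)"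
  by (induction n) simp_all

declare iact_Suc [simp del]

text \<open>To add a letter, naturality pulls the inner comultiplication back through the braiding
  with \<open>h\<close>, coassociativity regroups the three copies of C, and the hexagons fuse the
  braidings. The empty block is the counit law.\<close>

lemma iact_add:
  "iact (m + n) = (iact m \<boxtimes> iact n) \<bullet> (wid B [c] \<boxtimes> wbraid B [c] (hs m) \<boxtimes> wid B (hs n))
     \<bullet> (\<Delta>\<^bsub>C\<^esub> \<boxtimes> wid B (hs (m + n)))"
proof (induction m)
  case 0
  have "(\<epsilon>\<^bsub>C\<^esub> \<boxtimes> iact n) \<bullet> (\<Delta>\<^bsub>C\<^esub> \<boxtimes> wid B (hs n))
      = iact n \<bullet> (((\<epsilon>\<^bsub>C\<^esub> \<boxtimes> wid B [c]) \<bullet> \<Delta>\<^bsub>C\<^esub>) \<boxtimes> wid B (hs n))"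
    by (rule whisk_eqI) (simp_all add: layers)
  then show ?case by (simp add: C.counit_left)
next
  case (Suc m)
  let ?X = "(r \<boxtimes> iact m \<boxtimes> iact n) \<bullet> (wid B [c, h, c] \<boxtimes> wbraid B [c] (hs m) \<boxtimes> wid B (hs n))"
  have "iact (Suc m + n)
      = ?X \<bullet> (wid B [c] \<boxtimes> ((wid B [h] \<boxtimes> \<Delta>\<^bsub>C\<^esub>) \<bullet> wbraid B [c] [h]) \<boxtimes> wid B (hs (m + n)))
          \<bullet> (\<Delta>\<^bsub>C\<^esub> \<boxtimes> wid B (hs (Suc m + n)))"
    by (rule whisk_eqI) (simp_all add: layers Suc iact_Suc)
  also have "(wid B [h] \<boxtimes> \<Delta>\<^bsub>C\<^esub>) \<bullet> wbraid B [c] [h] = wbraid B [c, c] [h] \<bullet> (\<Delta>\<^bsub>C\<^esub> \<boxtimes> wid B [h])"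
    using wbraid_natural_left[of "\<Delta>\<^bsub>C\<^esub>" "[h]"] by simp
  also have "?X \<bullet> (wid B [c] \<boxtimes> (wbraid B [c, c] [h] \<bullet> (\<Delta>\<^bsub>C\<^esub> \<boxtimes> wid B [h])) \<boxtimes> wid B (hs (m + n)))
          \<bullet> (\<Delta>\<^bsub>C\<^esub> \<boxtimes> wid B (hs (Suc m + n)))
      = ?X \<bullet> (wid B [c] \<boxtimes> wbraid B [c, c] [h] \<boxtimes> wid B (hs (m + n)))
          \<bullet> (((wid B [c] \<boxtimes> \<Delta>\<^bsub>C\<^esub>) \<bullet> \<Delta>\<^bsub>C\<^esub>) \<boxtimes> wid B (hs (Suc m + n)))"
    by (rule whisk_eqI) (simp_all add: layers)
  also have "\<dots> = (iact (Suc m) \<boxtimes> iact n) \<bullet> (wid B [c] \<boxtimes> wbraid B [c] (hs (Suc m)) \<boxtimes> wid B (hs n))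
          \<bullet> (\<Delta>\<^bsub>C\<^esub> \<boxtimes> wid B (hs (Suc m + n)))"
    unfolding C.coassoc[symmetric]
    by (rule whisk_eqI) (simp_all add: layers wbraid_cc wbraid_c_hs iact_Suc)
  finally show ?case .
qed

text \<open>The spare copy of C meets a counit, which slides through the braiding and cancels the
  comultiplication.\<close>

lemma iact_1: "iact (Suc 0) = r"
proof -
  have "iact (Suc 0) = r \<bullet> (wid B [c] \<boxtimes> ((wid B [h] \<boxtimes> \<epsilon>\<^bsub>C\<^esub>) \<bullet> wbraid B [c] [h])) \<bullet> (\<Delta>\<^bsub>C\<^esub> \<boxtimes> wid B [h])"
    by (rule whisk_eqI) (simp_all add: layers iact_Suc)
  also have "(wid B [h] \<boxtimes> \<epsilon>\<^bsub>C\<^esub>) \<bullet> wbraid B [c] [h] = \<epsilon>\<^bsub>C\<^esub> \<boxtimes> wid B [h]"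
    using wbraid_natural_left[of "\<epsilon>\<^bsub>C\<^esub>" "[h]"] by simp
  also have "r \<bullet> (wid B [c] \<boxtimes> (\<epsilon>\<^bsub>C\<^esub> \<boxtimes> wid B [h])) \<bullet> (\<Delta>\<^bsub>C\<^esub> \<boxtimes> wid B [h])
      = r \<bullet> (((wid B [c] \<boxtimes> \<epsilon>\<^bsub>C\<^esub>) \<bullet> \<Delta>\<^bsub>C\<^esub>) \<boxtimes> wid B [h])"
    by (rule whisk_eqI) (simp_all add: layers)
  finally show ?thesis by (simp add: C.counit_right)
qed

text \<open>Makes compatibility local: \<open>iact_add\<close> isolates the block on which
  \<open>f\<close> operates, and naturality moves \<open>f\<close> past the copy of C that crosses
  the block. It is meant for \<open>f\<close> the counit or comultiplication of H.\<close>

lemma iact_whisker: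
  assumes [simp]: "war f" "wdom f = hs k" "wcod f = hs m" "war g" "wdom g = cs k" "wcod g = cs m"
    and fg: "iact m \<bullet> (wid B [c] \<boxtimes> f) = g \<bullet> iact k"
  shows "iact (a + (m + b)) \<bullet> (wid B [c] \<boxtimes> wid B (hs a) \<boxtimes> f \<boxtimes> wid B (hs b))
       = (wid B (cs a) \<boxtimes> g \<boxtimes> wid B (cs b)) \<bullet> iact (a + (k + b))"
proof -
  have "iact (m + b) \<bullet> (wid B [c] \<boxtimes> f \<boxtimes> wid B (hs b))
      = (iact m \<boxtimes> iact b) \<bullet> (wid B [c] \<boxtimes> (wbraid B [c] (hs m) \<bullet> (wid B [c] \<boxtimes> f)) \<boxtimes> wid B (hs b))
          \<bullet> (\<Delta>\<^bsub>C\<^esub> \<boxtimes> wid B (hs (k + b)))"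
    by (rule whisk_eqI) (simp_all add: layers iact_add[of m b])
  also have "wbraid B [c] (hs m) \<bullet> (wid B [c] \<boxtimes> f) = (f \<boxtimes> wid B [c]) \<bullet> wbraid B [c] (hs k)"
    using wbraid_natural_right[of f "[c]"] by simp
  also have "(iact m \<boxtimes> iact b) \<bullet> (wid B [c] \<boxtimes> ((f \<boxtimes> wid B [c]) \<bullet> wbraid B [c] (hs k)) \<boxtimes> wid B (hs b))
          \<bullet> (\<Delta>\<^bsub>C\<^esub> \<boxtimes> wid B (hs (k + b)))
      = ((iact m \<bullet> (wid B [c] \<boxtimes> f)) \<boxtimes> iact b) \<bullet> (wid B [c] \<boxtimes> wbraid B [c] (hs k) \<boxtimes> wid B (hs b))
          \<bullet> (\<Delta>\<^bsub>C\<^esub> \<boxtimes> wid B (hs (k + b)))"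
    by (rule whisk_eqI) (simp_all add: layers)
  also have "\<dots> = (g \<boxtimes> wid B (cs b)) \<bullet> iact (k + b)"
    unfolding fg by (rule whisk_eqI) (simp_all add: layers iact_add[of k b])
  finally have right: "iact (m + b) \<bullet> (wid B [c] \<boxtimes> f \<boxtimes> wid B (hs b))
      = (g \<boxtimes> wid B (cs b)) \<bullet> iact (k + b)" .
  have "iact (a + (m + b)) \<bullet> (wid B [c] \<boxtimes> wid B (hs a) \<boxtimes> f \<boxtimes> wid B (hs b))
      = (iact a \<boxtimes> (iact (m + b) \<bullet> (wid B [c] \<boxtimes> f \<boxtimes> wid B (hs b))))
          \<bullet> (wid B [c] \<boxtimes> wbraid B [c] (hs a) \<boxtimes> wid B (hs (k + b))) \<bullet> (\<Delta>\<^bsub>C\<^esub> \<boxtimes> wid B (hs (a + (k + b))))"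
    by (rule whisk_eqI) (simp_all add: layers iact_add[of a "m + b"])
  also have "\<dots> = (wid B (cs a) \<boxtimes> g \<boxtimes> wid B (cs b)) \<bullet> iact (a + (k + b))"
    unfolding right by (rule whisk_eqI) (simp_all add: layers iact_add[of a "k + b"])
  finally show ?thesis .
qed

lemma iact_counit: "iact 0 \<bullet> (wid B [c] \<boxtimes> \<epsilon>\<^bsub>H\<^esub>) = \<epsilon>\<^bsub>C\<^esub> \<bullet> iact (Suc 0)"
proof -
  have "\<epsilon>\<^bsub>C\<^esub> \<bullet> (wid B [c] \<boxtimes> \<epsilon>\<^bsub>H\<^esub>) = \<epsilon>\<^bsub>C\<^esub> \<boxtimes> \<epsilon>\<^bsub>H\<^esub>"
    by (rule whisk_eqI) (simp_all add: layers)
  then show ?thesis by (simp add: iact_1 counit_act)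
qed

lemma iact_comult: "iact (Suc (Suc 0)) \<bullet> (wid B [c] \<boxtimes> \<Delta>\<^bsub>H\<^esub>) = \<Delta>\<^bsub>C\<^esub> \<bullet> iact (Suc 0)"
proof -
  have "iact (Suc (Suc 0)) \<bullet> (wid B [c] \<boxtimes> \<Delta>\<^bsub>H\<^esub>)
      = (r \<boxtimes> r) \<bullet> (wid B [c] \<boxtimes> wbraid B [c] [h] \<boxtimes> wid B [h]) \<bullet> (\<Delta>\<^bsub>C\<^esub> \<boxtimes> \<Delta>\<^bsub>H\<^esub>)"
    by (rule whisk_eqI) (simp_all add: layers iact_1 iact_Suc[of "Suc 0"])
  then show ?thesis by (simp add: iact_1 comult_act)
qed

text \<open>The unit slides through the braiding and acts trivially, so the first copy of C comes
  out unacted.\<close>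

lemma iact_unit:
  "iact (Suc n) \<bullet> (wid B [c] \<boxtimes> \<eta>\<^bsub>H\<^esub> \<boxtimes> wid B (hs n)) = (wid B [c] \<boxtimes> iact n) \<bullet> (\<Delta>\<^bsub>C\<^esub> \<boxtimes> wid B (hs n))"
proof -
  have "iact (Suc n) \<bullet> (wid B [c] \<boxtimes> \<eta>\<^bsub>H\<^esub> \<boxtimes> wid B (hs n))
      = (r \<boxtimes> iact n) \<bullet> (wid B [c] \<boxtimes> (wbraid B [c] [h] \<bullet> (wid B [c] \<boxtimes> \<eta>\<^bsub>H\<^esub>)) \<boxtimes> wid B (hs n))
          \<bullet> (\<Delta>\<^bsub>C\<^esub> \<boxtimes> wid B (hs n))"
    by (rule whisk_eqI) (simp_all add: layers iact_Suc)
  also have "wbraid B [c] [h] \<bullet> (wid B [c] \<boxtimes> \<eta>\<^bsub>H\<^esub>) = \<eta>\<^bsub>H\<^esub> \<boxtimes> wid B [c]"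
    using wbraid_natural_right[of "\<eta>\<^bsub>H\<^esub>" "[c]"] by simp
  also have "(r \<boxtimes> iact n) \<bullet> (wid B [c] \<boxtimes> (\<eta>\<^bsub>H\<^esub> \<boxtimes> wid B [c]) \<boxtimes> wid B (hs n)) \<bullet> (\<Delta>\<^bsub>C\<^esub> \<boxtimes> wid B (hs n))
      = ((r \<bullet> (wid B [c] \<boxtimes> \<eta>\<^bsub>H\<^esub>)) \<boxtimes> iact n) \<bullet> (\<Delta>\<^bsub>C\<^esub> \<boxtimes> wid B (hs n))"
    by (rule whisk_eqI) (simp_all add: layers)
  finally show ?thesis by (simp add: act_unit)
qed

section \<open>The diagonal action of H\<close>

lemma diag_action_simps [simp]: "wdom (diag_action B H n) = h # hs n" "wcod (diag_action B H n) = hs n"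
  by (induction n) simp_all

lemma war_diag_action [simp]: "war (diag_action B H n)"
  by (induction n) simp_all

text \<open>By induction both sides reach one composite: two successive actions on the first copy of
  C, and one action followed by \<open>iact n\<close> on the second. On the left the product in H is
  pulled through the braiding and split by associativity of the action; on the right
  \<open>comult_act\<close> produces the two actions and one is pulled through.\<close>

lemma iact_diag_action:
  "iact n \<bullet> (wid B [c] \<boxtimes> diag_action B H n) = iact n \<bullet> (r \<boxtimes> wid B (hs n))"
proof (induction n)
  case 0
  have "\<epsilon>\<^bsub>C\<^esub> \<bullet> (wid B [c] \<boxtimes> \<epsilon>\<^bsub>H\<^esub>) = \<epsilon>\<^bsub>C\<^esub> \<boxtimes> \<epsilon>\<^bsub>H\<^esub>"
    by (rule whisk_eqI) (simp_all add: layers)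
  then show ?case by (simp add: counit_act)
next
  case (Suc n)
  let ?l = "diag_action B H n" and ?b = "wbraid B [c] [h]" and ?bh = "wbraid B [h] [h]"
  let ?D = "\<Delta>\<^bsub>C\<^esub> \<boxtimes> \<Delta>\<^bsub>H\<^esub> \<boxtimes> wid B (hs (Suc n))"
  have "iact (Suc n) \<bullet> (wid B [c] \<boxtimes> diag_action B H (Suc n))
      = (r \<boxtimes> iact n) \<bullet> (wid B [c] \<boxtimes> (?b \<bullet> (wid B [c] \<boxtimes> \<mu>\<^bsub>H\<^esub>)) \<boxtimes> ?l)
          \<bullet> (wid B [c, c, h] \<boxtimes> ?bh \<boxtimes> wid B (hs n)) \<bullet> ?D"
    by (rule whisk_eqI) (simp_all add: layers iact_Suc)
  also have "?b \<bullet> (wid B [c] \<boxtimes> \<mu>\<^bsub>H\<^esub>) = (\<mu>\<^bsub>H\<^esub> \<boxtimes> wid B [c]) \<bullet> wbraid B [c] [h, h]"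
    using wbraid_natural_right[of "\<mu>\<^bsub>H\<^esub>" "[c]"] by simp
  also have "(r \<boxtimes> iact n) \<bullet> (wid B [c] \<boxtimes> ((\<mu>\<^bsub>H\<^esub> \<boxtimes> wid B [c]) \<bullet> wbraid B [c] [h, h]) \<boxtimes> ?l)
          \<bullet> (wid B [c, c, h] \<boxtimes> ?bh \<boxtimes> wid B (hs n)) \<bullet> ?D
      = ((r \<bullet> (wid B [c] \<boxtimes> \<mu>\<^bsub>H\<^esub>)) \<boxtimes> (iact n \<bullet> (wid B [c] \<boxtimes> ?l)))
          \<bullet> (wid B [c] \<boxtimes> wbraid B [c] [h, h] \<boxtimes> wid B (h # hs n))
          \<bullet> (wid B [c, c, h] \<boxtimes> ?bh \<boxtimes> wid B (hs n)) \<bullet> ?D"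
    by (rule whisk_eqI) (simp_all add: layers)
  finally have lhs: "iact (Suc n) \<bullet> (wid B [c] \<boxtimes> diag_action B H (Suc n))
      = ((r \<bullet> (r \<boxtimes> wid B [h])) \<boxtimes> (iact n \<bullet> (r \<boxtimes> wid B (hs n))))
          \<bullet> (wid B [c] \<boxtimes> wbraid B [c] [h, h] \<boxtimes> wid B (h # hs n))
          \<bullet> (wid B [c, c, h] \<boxtimes> ?bh \<boxtimes> wid B (hs n)) \<bullet> ?D"
    \<comment> \<open>The induction hypothesis handles the last \<open>n\<close> letters,
      associativity of the action the first.\<close>
    unfolding Suc act_mult .
  have "iact (Suc n) \<bullet> (r \<boxtimes> wid B (hs (Suc n)))
      = (r \<boxtimes> iact n) \<bullet> (wid B [c] \<boxtimes> ?b \<boxtimes> wid B (hs n)) \<bullet> ((\<Delta>\<^bsub>C\<^esub> \<bullet> r) \<boxtimes> wid B (hs (Suc n)))"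
    by (rule whisk_eqI) (simp_all add: layers iact_Suc)
  also have "\<dots> = (r \<boxtimes> iact n) \<bullet> (r \<boxtimes> (?b \<bullet> (r \<boxtimes> wid B [h])) \<boxtimes> wid B (hs n))
          \<bullet> (wid B [c] \<boxtimes> ?b \<boxtimes> wid B (h # h # hs n)) \<bullet> ?D"
    unfolding comult_act by (rule whisk_eqI) (simp_all add: layers)
  also have "?b \<bullet> (r \<boxtimes> wid B [h]) = (wid B [h] \<boxtimes> r) \<bullet> wbraid B [c, h] [h]"
    using wbraid_natural_left[of r "[h]"] by simp
  also have "(r \<boxtimes> iact n) \<bullet> (r \<boxtimes> ((wid B [h] \<boxtimes> r) \<bullet> wbraid B [c, h] [h]) \<boxtimes> wid B (hs n))
          \<bullet> (wid B [c] \<boxtimes> ?b \<boxtimes> wid B (h # h # hs n)) \<bullet> ?D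
      = ((r \<bullet> (r \<boxtimes> wid B [h])) \<boxtimes> (iact n \<bullet> (r \<boxtimes> wid B (hs n))))
          \<bullet> (wid B [c] \<boxtimes> wbraid B [c] [h, h] \<boxtimes> wid B (h # hs n))
          \<bullet> (wid B [c, c, h] \<boxtimes> ?bh \<boxtimes> wid B (hs n)) \<bullet> ?D"
    by (rule whisk_eqI) (simp_all add: layers wbraid_ch wbraid_c_hh)
  finally show ?case unfolding lhs ..
qed

section \<open>Comparison with the iterated comultiplication\<close>

lemma factor_action_simps [simp]: "wdom (factor_action B H C (Suc n)) = cs (Suc n) @ hs (Suc n)"
  "wcod (factor_action B H C (Suc n)) = cs (Suc n)"
  by (induction n) (simp_all add: replicate_app_Cons_same)

lemma war_factor_action [simp]: "war (factor_action B H C (Suc n))"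
  by (induction n) (simp_all add: replicate_app_Cons_same)

lemma iter_comult_simps [simp]: "wdom (iter_comult B C n) = [c]" "wcod (iter_comult B C n) = cs (Suc n)"
  by (induction n) simp_all

lemma war_iter_comult [simp]: "war (iter_comult B C n)"
  by (induction n) simp_all

text \<open>Naturality delays the iterated comultiplication until the first letter of H has passed a
  single copy of C, which is the order used in \<open>iact\<close>.\<close>

lemma factor_action_iter_comult:
  "factor_action B H C (Suc n) \<bullet> (iter_comult B C n \<boxtimes> wid B (hs (Suc n))) = iact (Suc n)"
proof (induction n)
  case 0
  show ?case using iact_1 by simp
next
  case (Suc n)
  let ?D = "iter_comult B C n" and ?F = "factor_action B H C (Suc n)"
  have "factor_action B H C (Suc (Suc n)) \<bullet> (iter_comult B C (Suc n) \<boxtimes> wid B (hs (Suc (Suc n))))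
      = (r \<boxtimes> ?F) \<bullet> (wid B [c] \<boxtimes> (wbraid B (cs (Suc n)) [h] \<bullet> (?D \<boxtimes> wid B [h])) \<boxtimes> wid B (hs (Suc n)))
          \<bullet> (\<Delta>\<^bsub>C\<^esub> \<boxtimes> wid B (hs (Suc (Suc n))))"
    by (rule whisk_eqI) (simp_all add: layers)
  also have "wbraid B (cs (Suc n)) [h] \<bullet> (?D \<boxtimes> wid B [h]) = (wid B [h] \<boxtimes> ?D) \<bullet> wbraid B [c] [h]"
    using wbraid_natural_left[of ?D "[h]"] by simp
  also have "(r \<boxtimes> ?F) \<bullet> (wid B [c] \<boxtimes> ((wid B [h] \<boxtimes> ?D) \<bullet> wbraid B [c] [h]) \<boxtimes> wid B (hs (Suc n)))
          \<bullet> (\<Delta>\<^bsub>C\<^esub> \<boxtimes> wid B (hs (Suc (Suc n))))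
      = (r \<boxtimes> (?F \<bullet> (?D \<boxtimes> wid B (hs (Suc n))))) \<bullet> (wid B [c] \<boxtimes> wbraid B [c] [h] \<boxtimes> wid B (hs (Suc n)))
          \<bullet> (\<Delta>\<^bsub>C\<^esub> \<boxtimes> wid B (hs (Suc (Suc n))))"
    by (rule whisk_eqI) (simp_all add: layers)
  also have "\<dots> = iact (Suc (Suc n))"
    unfolding Suc by (simp add: iact_Suc)
  finally show ?case .
qed

end

section \<open>Invariant traces\<close>

locale braided_trace = twisted_category B + braided_module_coalgebra B H C + modular_pair B H \<delta> \<sigma>
  for B :: "('o, 'm, 'z) twisted_category_scheme" (structure)
    and H :: "('o, 'm, 'x) hopf_algebra_scheme"
    and C :: "('o, 'm, 'y) module_coalgebra_scheme" and \<delta> \<sigma> :: 'm +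
  fixes \<alpha> :: 'm
  assumes trace: "invariant_trace B H C \<delta> \<sigma> \<alpha>"
begin

abbreviation "d \<equiv> wchar H \<delta>"
abbreviation "s \<equiv> wpoint H \<sigma>"
abbreviation "a \<equiv> wpoint C \<alpha>"
abbreviation "S' \<equiv> twisted_antipode B H \<delta>"
abbreviation "\<theta> \<equiv> wtwist B [c]"

lemma war_trace_maps [simp]: "war d" "war s" "war a"
  using delta_hom sigma_hom trace
  by (simp_all add: war_def in_hom_iff invariant_trace_def)

lemma twisted_antipode_simps [simp]: "war S'" "wdom S' = [h]" "wcod S' = [h]"
  by (simp_all add: twisted_antipode_def)

lemma act_trace: "r \<bullet> (a \<boxtimes> wid B [h]) = a \<bullet> d"
  and trace_sigma: "(wid B [c] \<boxtimes> r) \<bullet> ((\<Delta>\<^bsub>C\<^esub> \<bullet> a) \<boxtimes> s)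
    = (wid B [c] \<boxtimes> \<theta>) \<bullet> wbraid B [c] [c] \<bullet> \<Delta>\<^bsub>C\<^esub> \<bullet> a"
  using trace by (simp_all add: invariant_trace_def)

text \<open>Comultiplying the invariance identity turns \<delta> into a diagonal action on both
  legs. Coassociativity in H then brings the action on the second leg next to the antipode, where
  the two cancel, leaving only the action on the first leg.\<close>

lemma act_twisted_antipode:
  "(wid B [c] \<boxtimes> r) \<bullet> ((\<Delta>\<^bsub>C\<^esub> \<bullet> a) \<boxtimes> S')
     = (r \<boxtimes> wid B [c]) \<bullet> (wid B [c] \<boxtimes> wbraid B [c] [h]) \<bullet> ((\<Delta>\<^bsub>C\<^esub> \<bullet> a) \<boxtimes> wid B [h])"
proof -
  let ?E = "\<Delta>\<^bsub>C\<^esub> \<bullet> a" and ?b = "wbraid B [c] [h]"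
  have "\<Delta>\<^bsub>C\<^esub> \<bullet> a \<bullet> d = (\<Delta>\<^bsub>C\<^esub> \<bullet> r) \<bullet> (a \<boxtimes> wid B [h])"
    by (simp add: act_trace)
  also have "\<dots> = (r \<boxtimes> r) \<bullet> (wid B [c] \<boxtimes> ?b \<boxtimes> wid B [h]) \<bullet> (?E \<boxtimes> \<Delta>\<^bsub>H\<^esub>)"
    unfolding comult_act by (rule whisk_eqI) (simp_all add: layers)
  finally have E: "\<Delta>\<^bsub>C\<^esub> \<bullet> a \<bullet> d = (r \<boxtimes> r) \<bullet> (wid B [c] \<boxtimes> ?b \<boxtimes> wid B [h]) \<bullet> (?E \<boxtimes> \<Delta>\<^bsub>H\<^esub>)" .
  have "(wid B [c] \<boxtimes> r) \<bullet> (?E \<boxtimes> S') = (wid B [c] \<boxtimes> r) \<bullet> ((\<Delta>\<^bsub>C\<^esub> \<bullet> a \<bullet> d) \<boxtimes> \<S>\<^bsub>H\<^esub>) \<bullet> \<Delta>\<^bsub>H\<^esub>"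
    by (rule whisk_eqI) (simp_all add: layers twisted_antipode_def)
  also have "\<dots> = (r \<boxtimes> (r \<bullet> (r \<boxtimes> wid B [h]))) \<bullet> (wid B [c] \<boxtimes> ?b \<boxtimes> wid B [h] \<boxtimes> \<S>\<^bsub>H\<^esub>)
      \<bullet> (?E \<boxtimes> ((\<Delta>\<^bsub>H\<^esub> \<boxtimes> wid B [h]) \<bullet> \<Delta>\<^bsub>H\<^esub>))"
    unfolding E by (rule whisk_eqI) (simp_all add: layers)
  also have "\<dots> = (r \<boxtimes> r) \<bullet> (wid B [c] \<boxtimes> ?b \<boxtimes> (\<mu>\<^bsub>H\<^esub> \<bullet> (wid B [h] \<boxtimes> \<S>\<^bsub>H\<^esub>) \<bullet> \<Delta>\<^bsub>H\<^esub>)) \<bullet> (?E \<boxtimes> \<Delta>\<^bsub>H\<^esub>)"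
    unfolding act_mult H.coassoc by (rule whisk_eqI) (simp_all add: layers)
  also have "\<dots> = (r \<boxtimes> (r \<bullet> (wid B [c] \<boxtimes> \<eta>\<^bsub>H\<^esub>))) \<bullet> (wid B [c] \<boxtimes> ?b)
      \<bullet> (?E \<boxtimes> ((wid B [h] \<boxtimes> \<epsilon>\<^bsub>H\<^esub>) \<bullet> \<Delta>\<^bsub>H\<^esub>))"
    unfolding H.antipode_right by (rule whisk_eqI) (simp_all add: layers)
  finally show ?thesis unfolding act_unit H.counit_right .
qed

text \<open>\<open>trace_map\<close> as a word arrow, uniform in \<open>n\<close>: at 0 the counit
  in \<open>iact 0\<close> gives back \<alpha>.\<close>

definition tmap :: "nat \<Rightarrow> ('o, 'm) warr" where
  "tmap n = (wid B [c] \<boxtimes> iact n) \<bullet> ((\<Delta>\<^bsub>C\<^esub> \<bullet> a) \<boxtimes> wid B (hs n))"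

lemma tmap_simps [simp]: "war (tmap n)" "wdom (tmap n) = hs n" "wcod (tmap n) = c # cs n"
  by (simp_all add: tmap_def)

lemma tmap_0: "tmap 0 = a"
proof -
  have "tmap 0 = ((wid B [c] \<boxtimes> \<epsilon>\<^bsub>C\<^esub>) \<bullet> \<Delta>\<^bsub>C\<^esub>) \<bullet> a"
    by (simp add: tmap_def)
  then show ?thesis by (simp add: C.counit_right)
qed

lemma trace_map_eq: "trace_map B H C \<alpha> n = und (tmap n)"
proof (cases n)
  case 0
  then show ?thesis by (simp add: trace_map_def tmap_0)
next
  case (Suc k)
  have "(wid B [c] \<boxtimes> factor_action B H C (Suc k))
        \<bullet> ((iter_comult B C (Suc k) \<bullet> a) \<boxtimes> wid B (hs (Suc k)))
      = (wid B [c] \<boxtimes> (factor_action B H C (Suc k) \<bullet> (iter_comult B C k \<boxtimes> wid B (hs (Suc k)))))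
        \<bullet> ((\<Delta>\<^bsub>C\<^esub> \<bullet> a) \<boxtimes> wid B (hs (Suc k)))"
    by (rule whisk_eqI) (simp_all add: layers)
  then show ?thesis
    using Suc by (simp only: factor_action_iter_comult trace_map_def tmap_def) simp
qed

text \<open>The diagonal action becomes an action on the second leg of the comultiplied trace, the
  twisted antipode moves it to the first leg, and this is the recursion for
  \<open>iact (Suc n)\<close>.\<close>

lemma tmap_twisted_antipode:
  "tmap n \<bullet> diag_action B H n \<bullet> (S' \<boxtimes> wid B (hs n)) = iact (Suc n) \<bullet> (a \<boxtimes> wid B (hs (Suc n)))"
proof -
  let ?E = "\<Delta>\<^bsub>C\<^esub> \<bullet> a"
  have "tmap n \<bullet> diag_action B H n \<bullet> (S' \<boxtimes> wid B (hs n))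
      = (wid B [c] \<boxtimes> (iact n \<bullet> (wid B [c] \<boxtimes> diag_action B H n))) \<bullet> (?E \<boxtimes> S' \<boxtimes> wid B (hs n))"
    by (rule whisk_eqI) (simp_all add: layers tmap_def)
  also have "\<dots> = (wid B [c] \<boxtimes> iact n) \<bullet> (((wid B [c] \<boxtimes> r) \<bullet> (?E \<boxtimes> S')) \<boxtimes> wid B (hs n))"
    unfolding iact_diag_action by (rule whisk_eqI) (simp_all add: layers)
  also have "\<dots> = iact (Suc n) \<bullet> (a \<boxtimes> wid B (hs (Suc n)))"
    unfolding act_twisted_antipode by (rule whisk_eqI) (simp_all add: layers iact_Suc)
  finally show ?thesis .
qed

text \<open>Covers \<open>n = 0\<close> as well, where the braiding with the empty word is an
  identity and the twist remains.\<close>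

definition tcyc :: "nat \<Rightarrow> ('o, 'm) warr" where
  "tcyc n = (wid B (cs n) \<boxtimes> \<theta>) \<bullet> wbraid B [c] (cs n)"

lemma tcyc_simps [simp]: "war (tcyc n)" "wdom (tcyc n) = c # cs n" "wcod (tcyc n) = c # cs n"
  by (simp_all add: tcyc_def replicate_append_same)

text \<open>The free leg of the comultiplied trace is braided past \<open>iact n\<close>. The
  hexagon separates its crossing with the other leg, to which the trace identity applies once the
  twist has been moved there; the action of \<sigma> so created is carried past the letters of H to
  the end.\<close>

lemma tcyc_tmap: "tcyc n \<bullet> tmap n = iact (Suc n) \<bullet> (a \<boxtimes> wid B (hs n) \<boxtimes> s)"
proof -
  let ?E = "\<Delta>\<^bsub>C\<^esub> \<bullet> a" and ?b = "wbraid B [c] (hs n)"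
  have nat_iact: "wbraid B [c] (cs n) \<bullet> (wid B [c] \<boxtimes> iact n)
      = (iact n \<boxtimes> wid B [c]) \<bullet> wbraid B [c] (c # hs n)"
    using wbraid_natural_right[of "iact n" "[c]"] by simp
  have hex: "wbraid B [c] (c # hs n) = (wid B [c] \<boxtimes> ?b) \<bullet> (wbraid B [c] [c] \<boxtimes> wid B (hs n))"
    using wbraid_append_right[of "[c]" "[c]" "hs n"] by simp
  have nat_twist: "(wid B (hs n) \<boxtimes> \<theta>) \<bullet> ?b = ?b \<bullet> (\<theta> \<boxtimes> wid B (hs n))"
    using wbraid_natural_left[of \<theta> "hs n"] by simp
  have nat_act: "?b \<bullet> (r \<boxtimes> wid B (hs n)) = (wid B (hs n) \<boxtimes> r) \<bullet> wbraid B [c, h] (hs n)"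
    using wbraid_natural_left[of r "hs n"] by simp
  \<comment> \<open>\<sigma> starts at the empty word, whose braiding is trivial.\<close>
  have nat_point: "wbraid B [h] (hs n) \<bullet> (s \<boxtimes> wid B (hs n)) = wid B (hs n) \<boxtimes> s"
    using wbraid_natural_left[of s "hs n"] by simp
  have "tcyc n \<bullet> tmap n = (wid B (cs n) \<boxtimes> \<theta>) \<bullet> (wbraid B [c] (cs n) \<bullet> (wid B [c] \<boxtimes> iact n))
      \<bullet> (?E \<boxtimes> wid B (hs n))"
    by (rule whisk_eqI) (simp_all add: layers tcyc_def tmap_def replicate_append_same)
  also have "\<dots> = (iact n \<boxtimes> wid B [c]) \<bullet> (wid B [c] \<boxtimes> ((wid B (hs n) \<boxtimes> \<theta>) \<bullet> ?b))
      \<bullet> ((wbraid B [c] [c] \<bullet> ?E) \<boxtimes> wid B (hs n))"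
    unfolding nat_iact hex by (rule whisk_eqI) (simp_all add: layers replicate_append_same)
  also have "\<dots> = (iact n \<boxtimes> wid B [c]) \<bullet> (wid B [c] \<boxtimes> ?b)
      \<bullet> (((wid B [c] \<boxtimes> \<theta>) \<bullet> wbraid B [c] [c] \<bullet> ?E) \<boxtimes> wid B (hs n))"
    unfolding nat_twist by (rule whisk_eqI) (simp_all add: layers replicate_append_same)
  also have "\<dots> = (iact n \<boxtimes> wid B [c]) \<bullet> (wid B [c] \<boxtimes> (?b \<bullet> (r \<boxtimes> wid B (hs n))))
      \<bullet> (?E \<boxtimes> s \<boxtimes> wid B (hs n))"
    unfolding trace_sigma[symmetric] by (rule whisk_eqI) (simp_all add: layers replicate_append_same)
  also have "\<dots> = (iact n \<boxtimes> r) \<bullet> (wid B [c] \<boxtimes> ?b \<boxtimes> wid B [h])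
      \<bullet> (?E \<boxtimes> (wbraid B [h] (hs n) \<bullet> (s \<boxtimes> wid B (hs n))))"
    unfolding nat_act wbraid_ch by (rule whisk_eqI) (simp_all add: layers replicate_append_same)
  \<comment> \<open>Reading the last action as \<open>iact 1\<close> brings the composite into the
    form of \<open>iact_add\<close>.\<close>
  also have "\<dots> = ((iact n \<boxtimes> iact 1) \<bullet> (wid B [c] \<boxtimes> ?b \<boxtimes> wid B (hs 1)) \<bullet> (\<Delta>\<^bsub>C\<^esub> \<boxtimes> wid B (hs (n + 1))))
      \<bullet> (a \<boxtimes> wid B (hs n) \<boxtimes> s)"
    unfolding nat_point by (rule whisk_eqI) (simp_all add: layers replicate_append_same iact_1)
  also have "\<dots> = iact (Suc n) \<bullet> (a \<boxtimes> wid B (hs n) \<boxtimes> s)"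
    unfolding iact_add[symmetric] by simp
  finally show ?thesis .
qed

text \<open>The twisted antipode and the inserted \<sigma> sit at opposite ends of the word, so
  \<sigma> can be inserted before everything else. A letter is needed for the antipode, hence
  \<open>Suc k\<close>.\<close>

lemma tmap_cycop:
  "tmap (Suc k) \<bullet> diag_action B H (Suc k) \<bullet> (S' \<boxtimes> wid B (hs k) \<boxtimes> s) = tcyc (Suc k) \<bullet> tmap (Suc k)"
proof -
  have "tmap (Suc k) \<bullet> diag_action B H (Suc k) \<bullet> (S' \<boxtimes> wid B (hs k) \<boxtimes> s)
      = (tmap (Suc k) \<bullet> diag_action B H (Suc k) \<bullet> (S' \<boxtimes> wid B (hs (Suc k))))
          \<bullet> (wid B [h] \<boxtimes> wid B (hs k) \<boxtimes> s)"
    by (rule whisk_eqI) (simp_all add: layers replicate_append_same del: diag_action.simps)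
  also have "\<dots> = tcyc (Suc k) \<bullet> tmap (Suc k)"
    unfolding tmap_twisted_antipode tcyc_tmap
    by (rule whisk_eqI) (simp_all add: layers replicate_append_same)
  finally show ?thesis .
qed

text \<open>The case 0 of \<open>tcyc_tmap\<close> turns the twist into the action of \<sigma> on
  \<alpha>; by invariance this is \<alpha> times \<delta>\<sigma>, the identity for a modular
  pair.\<close>

lemma tmap_cycop_0: "\<theta> \<bullet> a = a"
proof -
  have "\<theta> \<bullet> a = tcyc 0 \<bullet> tmap 0"
    by (simp add: tcyc_def tmap_0)
  also have "\<dots> = r \<bullet> (a \<boxtimes> s)"
    unfolding tcyc_tmap iact_1 by simp
  also have "\<dots> = (r \<bullet> (a \<boxtimes> wid B [h])) \<bullet> s"
    by (rule whisk_eqI) (simp_all add: layers)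
  also have "\<dots> = a"
    unfolding act_trace by (simp add: delta_sigma)
  finally show ?thesis .
qed

text \<open>A unit in the first slot leaves two copies of C unacted; by coassociativity they also
  arise from splitting the free copy.\<close>

lemma tmap_coface_first: "tmap (Suc k) \<bullet> (\<eta>\<^bsub>H\<^esub> \<boxtimes> wid B (hs k)) = (\<Delta>\<^bsub>C\<^esub> \<boxtimes> wid B (cs k)) \<bullet> tmap k"
proof -
  have "tmap (Suc k) \<bullet> (\<eta>\<^bsub>H\<^esub> \<boxtimes> wid B (hs k))
      = (wid B [c] \<boxtimes> (iact (Suc k) \<bullet> (wid B [c] \<boxtimes> \<eta>\<^bsub>H\<^esub> \<boxtimes> wid B (hs k)))) \<bullet> ((\<Delta>\<^bsub>C\<^esub> \<bullet> a) \<boxtimes> wid B (hs k))"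
    by (rule whisk_eqI) (simp_all add: layers tmap_def)
  also have "\<dots> = (wid B [c, c] \<boxtimes> iact k) \<bullet> ((((wid B [c] \<boxtimes> \<Delta>\<^bsub>C\<^esub>) \<bullet> \<Delta>\<^bsub>C\<^esub>) \<bullet> a) \<boxtimes> wid B (hs k))"
    unfolding iact_unit by (rule whisk_eqI) (simp_all add: layers)
  also have "\<dots> = (\<Delta>\<^bsub>C\<^esub> \<boxtimes> wid B (cs k)) \<bullet> tmap k"
    unfolding C.coassoc[symmetric] by (rule whisk_eqI) (simp_all add: layers tmap_def)
  finally show ?thesis .
qed

text \<open>A unit put in the first slot of \<open>tcyc_tmap\<close> frees one copy of C, and what
  is left is the trace map with \<sigma> as its last argument.\<close>

lemma tmap_coface_last: "tmap (Suc k) \<bullet> (wid B (hs k) \<boxtimes> s) = tcyc (Suc k) \<bullet> (\<Delta>\<^bsub>C\<^esub> \<boxtimes> wid B (cs k)) \<bullet> tmap k"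
proof -
  have "tcyc (Suc k) \<bullet> (\<Delta>\<^bsub>C\<^esub> \<boxtimes> wid B (cs k)) \<bullet> tmap k
      = (tcyc (Suc k) \<bullet> tmap (Suc k)) \<bullet> (\<eta>\<^bsub>H\<^esub> \<boxtimes> wid B (hs k))"
    unfolding tmap_coface_first[symmetric] by simp
  also have "\<dots> = (iact (Suc (Suc k)) \<bullet> (wid B [c] \<boxtimes> \<eta>\<^bsub>H\<^esub> \<boxtimes> wid B (hs (Suc k)))) \<bullet> (a \<boxtimes> wid B (hs k) \<boxtimes> s)"
    unfolding tcyc_tmap by (rule whisk_eqI) (simp_all add: layers replicate_append_same)
  also have "\<dots> = tmap (Suc k) \<bullet> (wid B (hs k) \<boxtimes> s)"
    unfolding iact_unit by (rule whisk_eqI) (simp_all add: layers tmap_def replicate_append_same)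
  finally show ?thesis ..
qed

text \<open>The shift to \<open>Suc i\<close> on the side of C accounts for the leading copy of C,
  on which H does not act.\<close>

lemma tmap_whisker:
  assumes [simp]: "war f" "wdom f = hs k" "wcod f = hs m" "war g" "wdom g = cs k" "wcod g = cs m"
    and fg: "iact m \<bullet> (wid B [c] \<boxtimes> f) = g \<bullet> iact k"
  shows "tmap (i + (m + j)) \<bullet> (wid B (hs i) \<boxtimes> f \<boxtimes> wid B (hs j))
       = (wid B (cs (Suc i)) \<boxtimes> g \<boxtimes> wid B (cs j)) \<bullet> tmap (i + (k + j))"
proof -
  let ?E = "\<Delta>\<^bsub>C\<^esub> \<bullet> a"
  have "tmap (i + (m + j)) \<bullet> (wid B (hs i) \<boxtimes> f \<boxtimes> wid B (hs j))
      = (wid B [c] \<boxtimes> (iact (i + (m + j)) \<bullet> (wid B [c] \<boxtimes> wid B (hs i) \<boxtimes> f \<boxtimes> wid B (hs j))))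
          \<bullet> (?E \<boxtimes> wid B (hs (i + (k + j))))"
    by (rule whisk_eqI) (simp_all add: layers tmap_def)
  also have "\<dots> = (wid B (cs (Suc i)) \<boxtimes> g \<boxtimes> wid B (cs j)) \<bullet> tmap (i + (k + j))"
    unfolding iact_whisker[OF assms] by (rule whisk_eqI) (simp_all add: layers tmap_def)
  finally show ?thesis .
qed

end

section \<open>Compatibility with cofaces, codegeneracies and operators\<close>

context braided_trace
begin

theorem paracocyclic_morphism_trace_map:
  "paracocyclic_morphism B (CM B H \<delta> \<sigma>) (CC B C) (trace_map B H C \<alpha>)"
  unfolding paracocyclic_morphism_def
proof (intro conjI allI impI; (elim conjE)?)
  fix n
  show "trace_map B H C \<alpha> n \<in> hom B (pobj (CM B H \<delta> \<sigma>) n) (pobj (CC B C) n)"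
    using tmap_simps[of n] by (simp add: trace_map_eq CM_def CC_def in_hom_iff)
next
  fix n i :: nat
  assume "1 \<le> n" "i \<le> n"
  then obtain k where n: "n = Suc k" by (cases n) auto
  consider "i = 0" | "0 < i" "i < n" | "i = n" "0 < i"
    using \<open>i \<le> n\<close> by linarith
  then show "trace_map B H C \<alpha> n \<cdot> coface (CM B H \<delta> \<sigma>) n i
      = coface (CC B C) n i \<cdot> trace_map B H C \<alpha> (n - 1)"
  proof cases
    case 1
    with n arg_cong[OF tmap_coface_first[of k], of und] show ?thesis
      by (simp add: trace_map_eq CM_def CC_def)
  next
    case 2
    \<comment> \<open>The comultiplied letter has \<open>p\<close> letters before it and
      \<open>q\<close> after it; on the side of C the block is preceded by \<open>p + 1 = i\<close>
      factors.\<close>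
    then obtain p q where "i = Suc p" "n = p + (Suc (Suc 0) + q)"
      by (metis add_Suc_right less_imp_Suc_add less_natE plus_nat.simps)
    with arg_cong[OF tmap_whisker[OF _ _ _ _ _ _ iact_comult, of p q], of und] show ?thesis
      by (simp add: trace_map_eq CM_def CC_def)
  next
    case 3
    with n arg_cong[OF tmap_coface_last[of k], of und] show ?thesis
      by (simp add: trace_map_eq CM_def CC_def tcyc_def replicate_append_same)
  qed
next
  fix n j :: nat
  assume "j \<le> n"
  then obtain q where "n = j + q" using le_Suc_ex by blast
  with arg_cong[OF tmap_whisker[OF _ _ _ _ _ _ iact_counit, of j q], of und]
  show "trace_map B H C \<alpha> n \<cdot> codeg (CM B H \<delta> \<sigma>) n j
      = codeg (CC B C) n j \<cdot> trace_map B H C \<alpha> (n + 1)"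
    by (simp add: trace_map_eq CM_def CC_def)
next
  fix n
  show "trace_map B H C \<alpha> n \<cdot> cycop (CM B H \<delta> \<sigma>) n = cycop (CC B C) n \<cdot> trace_map B H C \<alpha> n"
  proof (cases n)
    case 0
    \<comment> \<open>The operator on the source is an identity here; the typing of \<alpha> lets it
      cancel.\<close>
    have "\<alpha> \<in> Arr B" "Dom B \<alpha> = \<I>"
      using war_simps(3,4)[OF war_trace_maps(3)] by simp_all
    with arg_cong[OF tmap_cycop_0, of und] 0 show ?thesis
      by (simp add: trace_map_eq tmap_0 CM_def CC_def)
  next
    case (Suc k)
    with arg_cong[OF tmap_cycop[of k], of und] show ?thesis
      by (simp add: trace_map_eq CM_def CC_def tcyc_def replicate_append_same del: diag_action.simps)
  qed
qed

end

theorem theorem7: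
  fixes B :: "('o, 'm) twisted_category"
    and H :: "('o, 'm) hopf_algebra"
    and C :: "('o, 'm) module_coalgebra"
    and \<delta> \<sigma> \<alpha> :: 'm
  assumes "twisted_category B"
    and "hopf_algebra B H"
    and "module_coalgebra B H C"
    and "modular_pair B H \<delta> \<sigma>"
    and "invariant_trace B H C \<delta> \<sigma> \<alpha>"
  shows "paracocyclic_morphism B (CM B H \<delta> \<sigma>) (CC B C) (trace_map B H C \<alpha>)"
proof -
  have "braided_trace B H C \<delta> \<sigma> \<alpha>"
    using assms twisted_category.axioms(1)
    by (intro braided_trace.intro braided_module_coalgebra.intro braided_trace_axioms.intro) auto
  then show ?thesis
    by (rule braided_trace.paracocyclic_morphism_trace_map)
qed

end
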